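(* Let $(G,R)$ be a ridesharing instance of size $M$ with $l=|R|$ trips satisfying Conditions (1), (2), (3) and (5), and whose serve relation is transitive. Let $K=\max_{i\in R}n_i$. There is an algorithm that computes, in time $O(M+l^2)$, a solution $(S,\sigma)$ for $(G,R)$ such that $|S^*|\le|S|\le\frac{K+2}{2}|S^*|$, where $(S^*,\sigma^* )$ is any optimal solution (minimizing the number of drivers).
   Context: Ridesharing problem. A road network is an undirected graph $G$ with nonnegative edge lengths (travel time proportional to distance). An instance $(G,R)$ consists of $G$ and a set $R$ of trips, each trip $i$ having source $s_i$, destination $t_i$, capacity $n_i\ge0$ (seats for passengers), detour limit $d_i$, set $\mathcal P_i$ of preferred $s_i$–$t_i$ paths, stop limit $\delta_i$ (maximum number of pick-up stops at locations other than $s_i$), earliest departure time $\alpha_i$, latest arrival time $\beta_i$. Trip $i$ can serve $\sigma(i)\ni i$ if $i$'s vehicle can pick up each $j\in\sigma(i)\setminus\{i\}$ at $s_j$ (not before $\alpha_j$; $i$ leaves not before $\alpha_i$) and deliver each $j\in\sigma(i)$ to $t_j$ by $\beta_j$, with detour at most $d_i$ from a preferred path, at most $\delta_i$ pick-up stops, no re-taking of passengers ($|\sigma(i)|\le n_i+1$); $i$ can serve $j$ if $i$ can serve $\{i,j\}$. The serve relation is transitive if whenever $i$ can serve $j$ and $j$ can serve $k$, then $i$ can serve $k$. A solution $(S,\sigma)$: $S\subseteq R$ drivers, $\sigma:S\to2^R$, each $i\in S$ can serve $\sigma(i)$, the $\sigma(i)$ pairwise disjoint with union $R$. Conditions: (1)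 all $t_i$ equal a common vertex or all $s_i$ equal a common vertex; (2) $d_i=0$ for all $i$; (3) each $\mathcal P_i$ is a single path; (5) $\alpha_i=\alpha,\beta_i=\beta$ for all $i$, some $\alpha<\beta$. (Condition (4), $\delta_i\ge n_i$ for all $i$, is not required.)
   Formalization: Every trip is additionally assumed able to serve itself alone (its preferred path fits between α and β); without this there may be no solution at all, e.g. a single trip whose path is longer than β−α. *)

theory Defs
  imports Complex_Main "HOL-Library.Disjoint_Sets" "HOL-Library.Sublist"
begin

section \<open>Ridesharing instances\<close>

text \<open>
  Vertices are the numbers below \<open>nverts\<close>, and trips are identified with their positions in the list
  \<open>trips\<close>. Units are chosen such that travelling a distance takes an equal amount of time.
\<close>

record trip =
  source :: nat
  dest :: nat
  capacity :: nat
  detour_limit :: real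
  preferred :: "nat list list"
  stop_limit :: nat
  earliest :: real
  latest :: real

record instance_data =
  nverts :: nat
  edges :: "(nat \<times> nat \<times> real) list"
  trips :: "trip list"

abbreviation ntrips :: "instance_data \<Rightarrow> nat" where
  "ntrips I \<equiv> length (trips I)"

abbreviation trip_of :: "instance_data \<Rightarrow> nat \<Rightarrow> trip" where
  "trip_of I i \<equiv> trips I ! i"

definition is_edge :: "instance_data \<Rightarrow> nat \<Rightarrow> nat \<Rightarrow> real \<Rightarrow> bool" where
  "is_edge I u v w \<longleftrightarrow> (u, v, w) \<in> set (edges I) \<or> (v, u, w) \<in> set (edges I)"

definition adjacent :: "instance_data \<Rightarrow> nat \<Rightarrow> nat \<Rightarrow> bool" where
  "adjacent I u v \<longleftrightarrow> (\<exists>w. is_edge I u v w)"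

text \<open>Well defined on adjacent vertices because \<open>wf_instance\<close> below excludes parallel edges.\<close>

definition edge_length :: "instance_data \<Rightarrow> nat \<Rightarrow> nat \<Rightarrow> real" where
  "edge_length I u v = (THE w. is_edge I u v w)"

definition is_walk :: "instance_data \<Rightarrow> nat list \<Rightarrow> bool" where
  "is_walk I W \<longleftrightarrow> W \<noteq> [] \<and> set W \<subseteq> {..<nverts I} \<and> successively (adjacent I) W"

definition is_path :: "instance_data \<Rightarrow> nat \<Rightarrow> nat \<Rightarrow> nat list \<Rightarrow> bool" where
  "is_path I s t P \<longleftrightarrow> is_walk I P \<and> distinct P \<and> hd P = s \<and> last P = t"

definition walk_length :: "instance_data \<Rightarrow> nat list \<Rightarrow> real" where
  "walk_length I W = (\<Sum>k<length W - 1. edge_length I (W ! k) (W ! Suc k))"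

definition wf_trip :: "instance_data \<Rightarrow> trip \<Rightarrow> bool" where
  "wf_trip I T \<longleftrightarrow>
     source T < nverts I \<and> dest T < nverts I \<and> 0 \<le> detour_limit T \<and>
     distinct (preferred T) \<and> (\<forall>P\<in>set (preferred T). is_path I (source T) (dest T) P)"

definition wf_instance :: "instance_data \<Rightarrow> bool" where
  "wf_instance I \<longleftrightarrow>
     (\<forall>(u, v, w)\<in>set (edges I). u < nverts I \<and> v < nverts I \<and> u \<noteq> v \<and> 0 \<le> w) \<and>
     distinct (map (\<lambda>(u, v, w). {u, v}) (edges I)) \<and>
     (\<forall>T\<in>set (trips I). wf_trip I T)"

text \<open>
  The number of vertices plus the number of entries when the edges (two ends and a length) and the
  trips (seven numbers, the number of preferred paths, and each path as a length followed by its
  vertices) are written out one after the other, preceded by the numbers of vertices, edges and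
  trips.
\<close>

definition instance_size :: "instance_data \<Rightarrow> nat" where
  "instance_size I =
     3 + nverts I + 3 * length (edges I) +
     (\<Sum>T\<leftarrow>trips I. 8 + (\<Sum>P\<leftarrow>preferred T. 1 + length P))"

section \<open>The serve relation\<close>

text \<open>
  \<open>detour_length I P W x\<close>: the walk \<open>W\<close> follows \<open>P\<close> from start to end, where it may leave \<open>P\<close> at
  any vertex and return to \<open>P\<close> at the same or a later vertex; \<open>x\<close> is the total distance travelled
  between leaving and returning. In \<open>leave\<close>, \<open>Q\<close> is one such excursion and \<open>P'\<close> is the
  part of \<open>P\<close> that remains after it.
\<close>

inductive detour_length :: "instance_data \<Rightarrow> nat list \<Rightarrow> nat list \<Rightarrow> real \<Rightarrow> bool"
  for I :: instance_data where
  arrive: "detour_length I [v] [v] 0"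
| follow: "detour_length I (v # P) W x \<Longrightarrow> detour_length I (u # v # P) (u # W) x"
| leave: "\<lbrakk>suffix P' (u # P); P' \<noteq> []; is_walk I Q; hd Q = u; last Q = hd P'; detour_length I P' W x\<rbrakk>
    \<Longrightarrow> detour_length I (u # P) (butlast Q @ W) (walk_length I Q + x)"

text \<open>
  Limit 0 means that no detour is made, i.e. that the preferred path itself is driven. This has to
  be said separately since edges may have length 0.
\<close>

definition admissible_route :: "instance_data \<Rightarrow> trip \<Rightarrow> nat list \<Rightarrow> bool" where
  "admissible_route I T W \<longleftrightarrow>
     is_walk I W \<and> hd W = source T \<and> last W = dest T \<and>
     (\<exists>P\<in>set (preferred T).
        W = P \<or> (0 < detour_limit T \<and> (\<exists>x\<le>detour_limit T. detour_length I P W x)))"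

text \<open>Arrival and departure times for the positions of a route; waiting is allowed everywhere.\<close>

definition is_schedule :: "instance_data \<Rightarrow> nat list \<Rightarrow> (nat \<Rightarrow> real) \<Rightarrow> (nat \<Rightarrow> real) \<Rightarrow> bool" where
  "is_schedule I W arr dep \<longleftrightarrow>
     (\<forall>k<length W. arr k \<le> dep k) \<and>
     (\<forall>k. Suc k < length W \<longrightarrow> arr (Suc k) = dep k + edge_length I (W ! k) (W ! Suc k))"

text \<open>
  Passenger \<open>j\<close> is in the vehicle from position \<open>pick j\<close> to position \<open>drop j\<close> of the route. A seat
  is used by one passenger only, also after that passenger has left.
\<close>

definition can_serve_set :: "instance_data \<Rightarrow> nat \<Rightarrow> nat set \<Rightarrow> bool" where
  "can_serve_set I i A \<longleftrightarrow>
     i \<in> A \<and> A \<subseteq> {..<ntrips I} \<and>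
     card A \<le> capacity (trip_of I i) + 1 \<and>
     (\<exists>W arr dep. \<exists>pick drop :: nat \<Rightarrow> nat.
        admissible_route I (trip_of I i) W \<and>
        is_schedule I W arr dep \<and>
        earliest (trip_of I i) \<le> dep 0 \<and>
        arr (length W - 1) \<le> latest (trip_of I i) \<and>
        (\<forall>j\<in>A - {i}.
           pick j \<le> drop j \<and> drop j < length W \<and>
           W ! pick j = source (trip_of I j) \<and> earliest (trip_of I j) \<le> dep (pick j) \<and>
           W ! drop j = dest (trip_of I j) \<and> arr (drop j) \<le> latest (trip_of I j)) \<and>
        card {pick j |j. j \<in> A - {i} \<and> source (trip_of I j) \<noteq> source (trip_of I i)}
          \<le> stop_limit (trip_of I i))"

definition can_serve :: "instance_data \<Rightarrow> nat \<Rightarrow> nat \<Rightarrow> bool" where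
  "can_serve I i j \<longleftrightarrow> can_serve_set I i {i, j}"

definition serve_transitive :: "instance_data \<Rightarrow> bool" where
  "serve_transitive I \<longleftrightarrow>
     (\<forall>i<ntrips I. \<forall>j<ntrips I. \<forall>k<ntrips I.
        can_serve I i j \<longrightarrow> can_serve I j k \<longrightarrow> can_serve I i k)"

text \<open>
  Without this standing assumption an instance need not have any solution.
\<close>

definition serve_reflexive :: "instance_data \<Rightarrow> bool" where
  "serve_reflexive I \<longleftrightarrow> (\<forall>i<ntrips I. can_serve I i i)"

section \<open>Solutions\<close>

definition is_solution :: "instance_data \<Rightarrow> nat set \<Rightarrow> (nat \<Rightarrow> nat set) \<Rightarrow> bool" where
  "is_solution I S \<sigma> \<longleftrightarrow>
     S \<subseteq> {..<ntrips I} \<and> (\<forall>i\<in>S. can_serve_set I i (\<sigma> i)) \<and>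
     disjoint_family_on \<sigma> S \<and> (\<Union>i\<in>S. \<sigma> i) = {..<ntrips I}"

definition is_optimal :: "instance_data \<Rightarrow> nat set \<Rightarrow> (nat \<Rightarrow> nat set) \<Rightarrow> bool" where
  "is_optimal I S \<sigma> \<longleftrightarrow>
     is_solution I S \<sigma> \<and> (\<forall>S' \<sigma>'. is_solution I S' \<sigma>' \<longrightarrow> card S \<le> card S')"

section \<open>The conditions on instances\<close>

definition common_endpoint :: "instance_data \<Rightarrow> bool" where
  "common_endpoint I \<longleftrightarrow>
     (\<exists>t. \<forall>T\<in>set (trips I). dest T = t) \<or> (\<exists>s. \<forall>T\<in>set (trips I). source T = s)"

definition zero_detour :: "instance_data \<Rightarrow> bool" where
  "zero_detour I \<longleftrightarrow> (\<forall>T\<in>set (trips I). detour_limit T = 0)"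

definition single_path :: "instance_data \<Rightarrow> bool" where
  "single_path I \<longleftrightarrow> (\<forall>T\<in>set (trips I). \<exists>P. set (preferred T) = {P})"

definition common_time_window :: "instance_data \<Rightarrow> bool" where
  "common_time_window I \<longleftrightarrow>
     (\<exists>\<alpha> \<beta>. \<alpha> < \<beta> \<and> (\<forall>T\<in>set (trips I). earliest T = \<alpha> \<and> latest T = \<beta>))"

section \<open>Algorithms and their running time\<close>

text \<open>
  An algorithm is a program for a random access machine with unit costs, presented as a structured
  language with finitely many named variables and arrays. Integers and reals are
  separate sorts: reals can be added, subtracted, compared and stored, but not rounded or used as
  addresses. There is no multiplication. An expression contributes a fixed number of machine
  steps that depends on the program only, so assignments and tests are charged one step each.
\<close>

datatype iexp =
    IConst int
  | IVar string
  | IArr string iexp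
  | IAdd iexp iexp
  | ISub iexp iexp

datatype rexp =
    RConst int
  | RVar string
  | RArr string iexp
  | RAdd rexp rexp
  | RSub rexp rexp

datatype test =
    ILess iexp iexp
  | RLess rexp rexp
  | TNot test
  | TAnd test test

datatype prog =
    Skip
  | IAssign string iexp
  | IUpdate string iexp iexp
  | RAssign string rexp
  | RUpdate string iexp rexp
  | Seq prog prog
  | Cond test prog prog
  | While test prog

record state =
  ivar :: "string \<Rightarrow> int"
  iarr :: "string \<Rightarrow> int \<Rightarrow> int"
  rvar :: "string \<Rightarrow> real"
  rarr :: "string \<Rightarrow> int \<Rightarrow> real"

fun ival :: "iexp \<Rightarrow> state \<Rightarrow> int" where
  "ival (IConst c) s = c"
| "ival (IVar x) s = ivar s x"
| "ival (IArr a e) s = iarr s a (ival e s)"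
| "ival (IAdd e f) s = ival e s + ival f s"
| "ival (ISub e f) s = ival e s - ival f s"

fun rval :: "rexp \<Rightarrow> state \<Rightarrow> real" where
  "rval (RConst c) s = of_int c"
| "rval (RVar x) s = rvar s x"
| "rval (RArr a e) s = rarr s a (ival e s)"
| "rval (RAdd e f) s = rval e s + rval f s"
| "rval (RSub e f) s = rval e s - rval f s"

fun tval :: "test \<Rightarrow> state \<Rightarrow> bool" where
  "tval (ILess e f) s \<longleftrightarrow> ival e s < ival f s"
| "tval (RLess e f) s \<longleftrightarrow> rval e s < rval f s"
| "tval (TNot b) s \<longleftrightarrow> \<not> tval b s"
| "tval (TAnd b c) s \<longleftrightarrow> tval b s \<and> tval c s"

text \<open>\<open>exec p s n s'\<close>: started in \<open>s\<close>, the program \<open>p\<close> halts in \<open>s'\<close> after \<open>n\<close> steps.\<close>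

inductive exec :: "prog \<Rightarrow> state \<Rightarrow> nat \<Rightarrow> state \<Rightarrow> bool" where
  Skip: "exec Skip s 1 s"
| IAssign: "exec (IAssign x e) s 1 (s\<lparr>ivar := (ivar s)(x := ival e s)\<rparr>)"
| IUpdate: "exec (IUpdate a e f) s 1
    (s\<lparr>iarr := (iarr s)(a := (iarr s a)(ival e s := ival f s))\<rparr>)"
| RAssign: "exec (RAssign x r) s 1 (s\<lparr>rvar := (rvar s)(x := rval r s)\<rparr>)"
| RUpdate: "exec (RUpdate a e r) s 1
    (s\<lparr>rarr := (rarr s)(a := (rarr s a)(ival e s := rval r s))\<rparr>)"
| Seq: "exec p s m s' \<Longrightarrow> exec q s' n s'' \<Longrightarrow> exec (Seq p q) s (m + n) s''"
| CondT: "tval b s \<Longrightarrow> exec p s n s' \<Longrightarrow> exec (Cond b p q) s (1 + n) s'"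
| CondF: "\<not> tval b s \<Longrightarrow> exec q s n s' \<Longrightarrow> exec (Cond b p q) s (1 + n) s'"
| WhileF: "\<not> tval b s \<Longrightarrow> exec (While b p) s 1 s"
| WhileT: "tval b s \<Longrightarrow> exec p s m s' \<Longrightarrow> exec (While b p) s' n s'' \<Longrightarrow>
    exec (While b p) s (1 + m + n) s''"

inductive_cases Skip_elim: "exec Skip s n s'"
inductive_cases IAssign_elim: "exec (IAssign x e) s n s'"
inductive_cases IUpdate_elim: "exec (IUpdate a e f) s n s'"
inductive_cases RAssign_elim: "exec (RAssign x r) s n s'"
inductive_cases RUpdate_elim: "exec (RUpdate a e r) s n s'"
inductive_cases Seq_elim: "exec (Seq p q) s n s'"
inductive_cases Cond_elim: "exec (Cond b p q) s n s'"
inductive_cases While_elim: "exec (While b p) s n s'"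

lemma exec_deterministic:
  "exec p s n s' \<Longrightarrow> exec p s m s'' \<Longrightarrow> m = n \<and> s'' = s'"
proof (induction arbitrary: m s'' rule: exec.induct)
  case (Skip s)
  then show ?case by (rule Skip_elim) simp
next
  case (IAssign x e s)
  then show ?case by (rule IAssign_elim) simp
next
  case (IUpdate a e f s)
  then show ?case by (rule IUpdate_elim) simp
next
  case (RAssign x r s)
  then show ?case by (rule RAssign_elim) simp
next
  case (RUpdate a e r s)
  then show ?case by (rule RUpdate_elim) simp
next
  case (Seq p s k s1 q n s2)
  from Seq.prems obtain k' n' t where "m = k' + n'" "exec p s k' t" "exec q t n' s''"
    by (rule Seq_elim)
  then show ?case using Seq.IH(1)[of k' t] Seq.IH(2)[of n' s''] by simp
next
  case (CondT b s p n s' q)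
  from CondT.prems CondT.hyps(1) obtain n' where "m = 1 + n'" "exec p s n' s''"
    by (auto elim!: Cond_elim)
  then show ?case using CondT.IH[of n' s''] by simp
next
  case (CondF b s q n s' p)
  from CondF.prems CondF.hyps(1) obtain n' where "m = 1 + n'" "exec q s n' s''"
    by (auto elim!: Cond_elim)
  then show ?case using CondF.IH[of n' s''] by simp
next
  case (WhileF b s p)
  from WhileF.prems show ?case by (rule While_elim) (simp_all add: WhileF.hyps)
next
  case (WhileT b s p k s1 n s2)
  from WhileT.prems WhileT.hyps(1) obtain k' t n'
    where "m = 1 + k' + n'" "exec p s k' t" "exec (While b p) t n' s''"
    by (cases rule: exec.cases) simp_all
  then show ?case using WhileT.IH(1)[of k' t] WhileT.IH(2)[of n' s''] by simp
qed

text \<open>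
  Input format. The preferred paths of trip \<open>i\<close> are the paths with numbers from \<open>pathstart[i]\<close> to
  \<open>pathstart[i+1] - 1\<close>, and the vertices of path \<open>p\<close> are the entries of \<open>pathvert\<close> with numbers
  from \<open>vertstart[p]\<close> to \<open>vertstart[p+1] - 1\<close>. Everything else is initially 0.
\<close>

definition offsets :: "'a list list \<Rightarrow> nat list" where
  "offsets xss = map (\<lambda>k. length (concat (take k xss))) [0..<Suc (length xss)]"

definition array_of :: "'a::zero list \<Rightarrow> int \<Rightarrow> 'a" where
  "array_of xs k = (if 0 \<le> k \<and> nat k < length xs then xs ! nat k else 0)"

definition all_paths :: "instance_data \<Rightarrow> nat list list" where
  "all_paths I = concat (map preferred (trips I))"

definition int_array :: "nat list \<Rightarrow> int \<Rightarrow> int" where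
  "int_array xs = array_of (map int xs)"

definition input_state :: "instance_data \<Rightarrow> state" where
  "input_state I = \<lparr>
     ivar = (\<lambda>_. 0)(
       ''nverts'' := int (nverts I),
       ''nedges'' := int (length (edges I)),
       ''ntrips'' := int (ntrips I)),
     iarr = (\<lambda>_ _. 0)(
       ''edge1'' := int_array (map (\<lambda>(u, v, w). u) (edges I)),
       ''edge2'' := int_array (map (\<lambda>(u, v, w). v) (edges I)),
       ''source'' := int_array (map source (trips I)),
       ''dest'' := int_array (map dest (trips I)),
       ''capacity'' := int_array (map capacity (trips I)),
       ''stops'' := int_array (map stop_limit (trips I)),
       ''pathstart'' := int_array (offsets (map preferred (trips I))),
       ''vertstart'' := int_array (offsets (all_paths I)),
       ''pathvert'' := int_array (concat (all_paths I))),
     rvar = (\<lambda>_. 0),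
     rarr = (\<lambda>_ _. 0)(
       ''edgelength'' := array_of (map (\<lambda>(u, v, w). w) (edges I)),
       ''detour'' := array_of (map detour_limit (trips I)),
       ''earliest'' := array_of (map earliest (trips I)),
       ''latest'' := array_of (map latest (trips I)))\<rparr>"

text \<open>
  Output format: entry \<open>j\<close> of the array \<open>driver\<close> is the driver that serves trip \<open>j\<close>, which is \<open>j\<close>
  itself exactly if \<open>j\<close> is a driver.
\<close>

definition output_drivers :: "instance_data \<Rightarrow> state \<Rightarrow> nat set" where
  "output_drivers I s = {i. i < ntrips I \<and> iarr s ''driver'' (int i) = int i}"

definition output_served :: "instance_data \<Rightarrow> state \<Rightarrow> nat \<Rightarrow> nat set" where
  "output_served I s i = {j. j < ntrips I \<and> iarr s ''driver'' (int j) = int i}"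

end

theory Submission
  imports Defs
begin

text \<open>
  Under the conditions, trip \<open>i\<close> can serve a set exactly if source and destination of its members
  lie on the route of \<open>i\<close>, there are enough seats, and the number of distinct sources other than
  that of \<open>i\<close> is within the stop limit. Call \<open>deg i\<close> the number of trips that \<open>i\<close> can take.
  By transitivity \<open>deg\<close> decreases along the serve relation, and related trips of equal degree can
  take the same trips.

  The algorithm examines the trips in the order of increasing degree. If nobody has boarded yet, \<open>i\<close>
  takes trips of smaller degree that are neither passengers nor have passengers, opening
  the sources with the most such trips first. A second sweep does the same with
  equal degrees allowed. Then at least half as many passengers are served as in an optimal solution
  \<open>(S\<^sup>*, \<sigma>\<^sup>*)\<close>. Indeed, charge a passenger of \<open>\<sigma>\<^sup>*\<close> to itself if it is a passenger here, to
  one of its own passengers if it has any, and otherwise, as a member of \<open>\<sigma>\<^sup>*(i)\<close>, to a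
  passenger of \<open>i\<close>, or to \<open>i\<close> if \<open>i\<close> is a passenger itself, which happens at most once since
  such a member has the degree of \<open>i\<close> and two lonely trips of equal degree would have been joined.
  Every passenger is charged at most twice. With \<open>p \<ge> (l - |S\<^sup>*|) / 2\<close> passengers and
  \<open>l \<le> (K + 1) |S\<^sup>*|\<close> one gets \<open>|S| = l - p \<le> (l + |S\<^sup>*|) / 2 \<le> (K + 2) / 2 |S\<^sup>*|\<close>.

  Each choice of a passenger scans all trips once, and there are at most \<open>l\<close> such choices.
\<close>

section \<open>The serve relation under the conditions\<close>

abbreviation source_of :: "instance_data \<Rightarrow> nat \<Rightarrow> nat" where
  "source_of I j \<equiv> source (trip_of I j)"

definition route :: "instance_data \<Rightarrow> nat \<Rightarrow> nat list" where
  "route I i = hd (preferred (trip_of I i))"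

text \<open>\<open>A\<close> consists of passengers only, so no seat is added for the driver. Times
  and the order of the stops are absent because the conditions settle them, as
  \<open>can_serve_set_iff\<close> shows.\<close>

definition feasible_load :: "instance_data \<Rightarrow> nat \<Rightarrow> nat set \<Rightarrow> bool" where
  "feasible_load I i A \<longleftrightarrow>
     A \<subseteq> {..<ntrips I} \<and>
     (\<forall>j\<in>A. source_of I j \<in> set (route I i) \<and> dest (trip_of I j) \<in> set (route I i)) \<and>
     card A \<le> capacity (trip_of I i) \<and>
     card (source_of I ` A - {source_of I i}) \<le> stop_limit (trip_of I i)"

locale ridesharing =
  fixes I :: instance_data
  assumes wf: "wf_instance I"
    and reflexive: "serve_reflexive I"
    and common_endpoint: "common_endpoint I"
    and zero_detour: "zero_detour I"
    and single_path: "single_path I"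
    and common_time_window: "common_time_window I"
    and transitive: "serve_transitive I"
begin

abbreviation l :: nat where "l \<equiv> ntrips I"
abbreviation src :: "nat \<Rightarrow> nat" where "src \<equiv> source_of I"
abbreviation dst :: "nat \<Rightarrow> nat" where "dst j \<equiv> dest (trip_of I j)"
abbreviation cap :: "nat \<Rightarrow> nat" where "cap i \<equiv> capacity (trip_of I i)"
abbreviation stp :: "nat \<Rightarrow> nat" where "stp i \<equiv> stop_limit (trip_of I i)"
abbreviation feas :: "nat \<Rightarrow> nat set \<Rightarrow> bool" where "feas \<equiv> feasible_load I"

lemma preferred_eq:
  assumes "i < l"
  shows "preferred (trip_of I i) = [route I i]"
proof -
  have mem: "trip_of I i \<in> set (trips I)" using assms by simp
  then obtain P where P: "set (preferred (trip_of I i)) = {P}"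
    using single_path by (auto simp: single_path_def)
  have "distinct (preferred (trip_of I i))"
    using wf mem by (auto simp: wf_instance_def wf_trip_def)
  then have "length (preferred (trip_of I i)) = 1"
    using P distinct_card by fastforce
  then show ?thesis
    by (cases "preferred (trip_of I i)") (auto simp: route_def)
qed

lemma route_path:
  assumes "i < l"
  shows "is_path I (src i) (dst i) (route I i)"
proof -
  have "trip_of I i \<in> set (trips I)" using assms by simp
  then show ?thesis
    using wf preferred_eq[OF assms] by (auto simp: wf_instance_def wf_trip_def)
qed

lemma route_ne: "i < l \<Longrightarrow> route I i \<noteq> []"
  and route_distinct: "i < l \<Longrightarrow> distinct (route I i)"
  and route_hd: "i < l \<Longrightarrow> hd (route I i) = src i"
  and route_last: "i < l \<Longrightarrow> last (route I i) = dst i"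
  by (drule route_path, simp add: is_path_def is_walk_def)+

lemma admissible_iff:
  assumes "i < l"
  shows "admissible_route I (trip_of I i) W \<longleftrightarrow> W = route I i"
proof -
  have "detour_limit (trip_of I i) = 0"
    using assms zero_detour by (auto simp: zero_detour_def)
  then show ?thesis
    using preferred_eq[OF assms] route_path[OF assms]
    by (auto simp: admissible_route_def is_path_def)
qed

text \<open>\<open>edge_length\<close> is given by a description operator, so uniqueness of the
  length comes first. It holds because the end sets in the edge list are distinct, which makes two
  entries with the same ends equal.\<close>

lemma edge_length_nonneg:
  assumes "adjacent I u v"
  shows "0 \<le> edge_length I u v"
proof -
  obtain w where w: "is_edge I u v w" using assms by (auto simp: adjacent_def)
  have dist: "distinct (map (\<lambda>(u, v, w). {u, v}) (edges I))"
    and nonneg: "\<forall>(u, v, w)\<in>set (edges I). 0 \<le> w"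
    using wf by (auto simp: wf_instance_def)
  have inj: "inj_on (\<lambda>(u, v, w). {u, v}) (set (edges I))"
    using dist by (simp add: distinct_map)
  have "w' = w" if w': "is_edge I u v w'" for w'
  proof -
    obtain e where e: "e \<in> set (edges I)" "e = (u, v, w) \<or> e = (v, u, w)"
      using w unfolding is_edge_def by blast
    obtain e' where e': "e' \<in> set (edges I)" "e' = (u, v, w') \<or> e' = (v, u, w')"
      using w' unfolding is_edge_def by blast
    have "e = e'"
      using inj_onD[OF inj _ e(1) e'(1)] e(2) e'(2) by (auto simp: insert_commute)
    then show ?thesis using e e' by auto
  qed
  then have "edge_length I u v = w"
    unfolding edge_length_def using w by blast
  then show ?thesis using nonneg w by (auto simp: is_edge_def)
qed

text \<open>Transfers the driver's time limits, which concern the two ends of the route, to the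
  stops in between.\<close>

lemma schedule_mono:
  assumes walk: "is_walk I W" and sch: "is_schedule I W arr dep"
  shows "k \<le> m \<Longrightarrow> m < length W \<Longrightarrow> arr k \<le> arr m \<and> dep k \<le> dep m"
proof (induction m rule: dec_induct)
  case base
  show ?case by simp
next
  case (step m)
  have "adjacent I (W ! m) (W ! Suc m)"
    using walk step.prems by (auto simp: is_walk_def successively_conv_nth)
  then have "0 \<le> edge_length I (W ! m) (W ! Suc m)" by (rule edge_length_nonneg)
  moreover have "arr (Suc m) = dep m + edge_length I (W ! m) (W ! Suc m)"
    "arr m \<le> dep m" "arr (Suc m) \<le> dep (Suc m)"
    using sch step.prems by (auto simp: is_schedule_def)
  ultimately show ?case using step by auto
qed

text \<open>With a common source or destination, pick-up before drop-off is automatic. With a common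
  time window, a schedule that suits the driver suits everybody. As the route repeats no vertex,
  stops can be counted by sources.\<close>

lemma can_serve_set_iff:
  assumes i: "i < l"
  shows "can_serve_set I i A \<longleftrightarrow> i \<in> A \<and> A \<subseteq> {..<l} \<and> feas i (A - {i})"
proof (cases "i \<in> A \<and> A \<subseteq> {..<l}")
  case False
  then show ?thesis by (auto simp: can_serve_set_def)
next
  case True
  let ?P = "route I i"
  have fin: "finite A" using True finite_subset by blast
  have cardA: "card (A - {i}) \<le> cap i \<longleftrightarrow> card A \<le> cap i + 1"
    using True fin by (simp add: card_Diff_singleton) linarith
  \<comment> \<open>Distinct positions of the route hold distinct vertices, so pick-up positions and
    sources correspond one to one.\<close>
  have pick_card: "card {pick j |j. j \<in> A - {i} \<and> src j \<noteq> src i} = card (src ` (A - {i}) - {src i})"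
    if pick: "\<forall>j\<in>A - {i}. pick j < length ?P \<and> ?P ! pick j = src j" for pick :: "nat \<Rightarrow> nat"
  proof -
    let ?K = "{pick j |j. j \<in> A - {i} \<and> src j \<noteq> src i}"
    have "(!) ?P ` ?K = src ` (A - {i}) - {src i}"
      using pick by (force simp: image_iff)
    moreover have "card ((!) ?P ` ?K) = card ?K"
      using pick route_distinct[OF i] by (intro card_image inj_on_nth) auto
    ultimately show ?thesis by (simp only:)
  qed
  show ?thesis
  proof
    assume "can_serve_set I i A"
    then obtain W arr dep pick drop where
      W: "admissible_route I (trip_of I i) W" and
      seats: "card A \<le> cap i + 1" and
      pd: "\<forall>j\<in>A - {i}. pick j \<le> drop j \<and> drop j < length W \<and>
        W ! pick j = src j \<and> W ! drop j = dst j" and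
      stops: "card {pick j |j. j \<in> A - {i} \<and> src j \<noteq> src i} \<le> stp i"
      unfolding can_serve_set_def by blast
    have W: "W = ?P" using W admissible_iff[OF i] by simp
    have "\<forall>j\<in>A - {i}. pick j < length ?P \<and> ?P ! pick j = src j"
      using pd W by (meson le_less_trans)
    moreover have "\<forall>j\<in>A - {i}. src j \<in> set ?P \<and> dst j \<in> set ?P"
    proof
      fix j assume "j \<in> A - {i}"
      then show "src j \<in> set ?P \<and> dst j \<in> set ?P"
        using pd W by (metis le_less_trans nth_mem)
    qed
    ultimately show "i \<in> A \<and> A \<subseteq> {..<l} \<and> feas i (A - {i})"
      using True cardA seats stops pick_card by (auto simp: feasible_load_def)
  next
    assume feas: "i \<in> A \<and> A \<subseteq> {..<l} \<and> feas i (A - {i})"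
    \<comment> \<open>Reflexivity supplies a schedule that meets the time limits. It is made for
      \<open>i\<close> alone, and is used unchanged for all of \<open>A\<close>.\<close>
    have "can_serve_set I i {i}"
      using reflexive i by (auto simp: serve_reflexive_def can_serve_def)
    then obtain W arr dep where
      W: "admissible_route I (trip_of I i) W" and
      sch: "is_schedule I W arr dep" and
      early: "earliest (trip_of I i) \<le> dep 0" and
      late: "arr (length W - 1) \<le> latest (trip_of I i)"
      by (auto simp: can_serve_set_def)
    have WP: "W = ?P" using W admissible_iff[OF i] by simp
    have walk: "is_walk I ?P" using route_path[OF i] by (simp add: is_path_def)
    note mono = schedule_mono[OF walk sch[unfolded WP]]
    have len: "0 < length ?P" using route_ne[OF i] by simp
    have ends: "?P ! 0 = src i" "?P ! (length ?P - 1) = dst i"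
      using route_hd[OF i] route_last[OF i] route_ne[OF i]
      by (simp_all add: hd_conv_nth last_conv_nth)
    have same: "earliest (trip_of I j) = earliest (trip_of I i) \<and>
        latest (trip_of I j) = latest (trip_of I i)" if "j \<in> A" for j
    proof -
      have "j < l" using that True by auto
      then show ?thesis
        using common_time_window i nth_mem[of j "trips I"] nth_mem[of i "trips I"]
        unfolding common_time_window_def by metis
    qed
    have "\<exists>p q. p \<le> q \<and> q < length ?P \<and> ?P ! p = src j \<and> ?P ! q = dst j"
      if j: "j \<in> A - {i}" for j
    proof -
      have jl: "j < l" using j True by auto
      have on: "src j \<in> set ?P" "dst j \<in> set ?P"
        using feas j by (auto simp: feasible_load_def)
      \<comment> \<open>A common destination is the end of the route, so every pick-up precedes it;
        a common source is position 0, so every drop-off follows it.\<close>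
      from common_endpoint i jl have "dst j = dst i \<or> src j = src i"
        unfolding common_endpoint_def by (metis nth_mem)
      then show ?thesis
      proof
        assume "dst j = dst i"
        moreover obtain p where "p < length ?P" "?P ! p = src j"
          using on by (auto simp: in_set_conv_nth)
        ultimately show ?thesis
          using ends by (intro exI[of _ p] exI[of _ "length ?P - 1"]) auto
      next
        assume "src j = src i"
        moreover obtain q where "q < length ?P" "?P ! q = dst j"
          using on by (auto simp: in_set_conv_nth)
        ultimately show ?thesis
          using ends by (intro exI[of _ 0] exI[of _ q]) auto
      qed
    qed
    then obtain pick drop where
      pd: "\<And>j. j \<in> A - {i} \<Longrightarrow> pick j \<le> drop j \<and> drop j < length ?P \<and>
        ?P ! pick j = src j \<and> ?P ! drop j = dst j"
      by metis
    have times: "earliest (trip_of I j) \<le> dep (pick j) \<and> arr (drop j) \<le> latest (trip_of I j)"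
      if j: "j \<in> A - {i}" for j
    proof -
      have "dep 0 \<le> dep (pick j)" using pd[OF j] mono[of 0 "pick j"] by auto
      moreover have "arr (drop j) \<le> arr (length ?P - 1)"
        using pd[OF j] mono[of "drop j" "length ?P - 1"] len by auto
      ultimately show ?thesis using same[of j] j early late WP by auto
    qed
    have "card {pick j |j. j \<in> A - {i} \<and> src j \<noteq> src i} = card (src ` (A - {i}) - {src i})"
      using pd by (intro pick_card) (meson le_less_trans)
    then have stops: "card {pick j |j. j \<in> A - {i} \<and> src j \<noteq> src i} \<le> stp i"
      using feas by (simp add: feasible_load_def)
    show "can_serve_set I i A"
      unfolding can_serve_set_def
      using True cardA feas
    proof (intro conjI, goal_cases)
      case 4
      show ?case
        by (rule exI[of _ ?P], rule exI[of _ arr], rule exI[of _ dep], rule exI[of _ pick],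
          rule exI[of _ drop]) (use W sch early late pd times stops WP in \<open>simp\<close>)
    qed (auto simp: feasible_load_def)
  qed
qed

section \<open>Degrees and transitivity\<close>

definition rides :: "nat \<Rightarrow> nat \<Rightarrow> bool" where
  "rides i j \<longleftrightarrow> feas i {j}"

definition deg :: "nat \<Rightarrow> nat" where
  "deg i = card {j. rides i j}"

lemma rides_iff:
  "rides i j \<longleftrightarrow> j < l \<and> src j \<in> set (route I i) \<and> dst j \<in> set (route I i) \<and> 0 < cap i \<and>
     (src j = src i \<or> 0 < stp i)"
  by (auto simp: rides_def feasible_load_def insert_Diff_if Suc_le_eq)

lemma rides_finite: "finite {j. rides i j}"
  by (rule finite_subset[of _ "{..<l}"]) (auto simp: rides_iff)

lemma deg_le: "deg i \<le> l"
proof -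
  have "card {j. rides i j} \<le> card {..<l}" by (intro card_mono) (auto simp: rides_iff)
  then show ?thesis by (simp add: deg_def)
qed

lemma feas_finite: "feas i A \<Longrightarrow> finite A"
  unfolding feasible_load_def using finite_subset[OF _ finite_lessThan] by blast

lemma feas_subset:
  assumes "feas i A" "B \<subseteq> A"
  shows "feas i B"
proof -
  have fin: "finite A" using assms feas_finite by simp
  have "card B \<le> card A" using fin assms(2) by (rule card_mono)
  moreover have "card (src ` B - {src i}) \<le> card (src ` A - {src i})"
    using fin assms(2) by (intro card_mono) auto
  ultimately show ?thesis using assms by (auto simp: feasible_load_def)
qed

lemma feas_rides: "feas i A \<Longrightarrow> j \<in> A \<Longrightarrow> rides i j"
  unfolding rides_def by (erule feas_subset) simp

text \<open>Carrying anybody shows that \<open>i\<close> has a seat, and its own ends lie on its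
  route and cost no stop. On the diagonal \<open>rides\<close> is stronger than
  \<open>can_serve\<close>: a trip without seats serves itself, but \<open>rides i i\<close>
  fails.\<close>

lemma rides_self: "i < l \<Longrightarrow> rides i j \<Longrightarrow> rides i i"
proof -
  assume i: "i < l" and "rides i j"
  moreover have "src i \<in> set (route I i)" "dst i \<in> set (route I i)"
    using hd_in_set[OF route_ne[OF i]] last_in_set[OF route_ne[OF i]]
    by (simp_all only: route_hd[OF i] route_last[OF i])
  ultimately show "rides i i" unfolding rides_iff by blast
qed

lemma rides_can_serve:
  assumes "i < l" "j < l" "i \<noteq> j"
  shows "can_serve I i j \<longleftrightarrow> rides i j"
proof -
  have "{i, j} - {i} = {j}" using assms by auto
  then show ?thesis
    using assms by (auto simp: can_serve_def can_serve_set_iff rides_def)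
qed

text \<open>\<open>serve_transitive\<close> is used for three distinct trips, where
  \<open>rides\<close> and \<open>can_serve\<close> agree. The only other case of substance is
  \<open>i = k\<close>, settled by \<open>rides_self\<close>.\<close>

lemma rides_trans:
  assumes i: "i < l" and ij: "rides i j" and jk: "rides j k"
  shows "rides i k"
proof -
  have j: "j < l" and k: "k < l" using ij jk by (auto simp: rides_iff)
  consider "i = j" | "j = k" | "i = k" | "i \<noteq> j" "j \<noteq> k" "i \<noteq> k" by blast
  then show ?thesis
  proof cases
    case 3
    then show ?thesis using rides_self[OF i ij] by blast
  next
    case 4
    then have "can_serve I i j" "can_serve I j k"
      using rides_can_serve i j k ij jk by blast+
    then have "can_serve I i k"
      using transitive i j k unfolding serve_transitive_def by blast
    then show ?thesis using rides_can_serve i k 4 by blast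
  qed (use ij jk in auto)
qed

lemma rides_deg_le: "i < l \<Longrightarrow> rides i j \<Longrightarrow> deg j \<le> deg i"
  unfolding deg_def by (intro card_mono rides_finite) (auto intro: rides_trans)

text \<open>By transitivity \<open>j\<close> can take only what \<open>i\<close> can take, and a
  subset of a finite set of the same size is the whole set.\<close>

lemma rides_deg_eq:
  assumes "i < l" "rides i j" "deg j = deg i" "rides i k"
  shows "rides j k"
proof -
  have "{k. rides j k} = {k. rides i k}"
    using assms by (intro card_subset_eq rides_finite) (auto intro: rides_trans simp: deg_def)
  then show ?thesis using assms by blast
qed

subsection \<open>Assignments of passengers\<close>

definition passengers :: "(nat \<Rightarrow> nat) \<Rightarrow> nat \<Rightarrow> nat set" where
  "passengers D i = {j. j < l \<and> j \<noteq> i \<and> D j = i}"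

definition valid :: "(nat \<Rightarrow> nat) \<Rightarrow> bool" where
  "valid D \<longleftrightarrow> (\<forall>i<l. D i < l \<and> D (D i) = D i \<and> feas i (passengers D i))"

definition free :: "(nat \<Rightarrow> nat) \<Rightarrow> nat \<Rightarrow> bool" where
  "free D j \<longleftrightarrow> D j = j \<and> passengers D j = {}"

text \<open>For \<open>i < l\<close>, \<open>b = 0\<close> keeps to strictly smaller degrees, while
  \<open>b = 1\<close> admits every other free trip that \<open>i\<close> can take, because degrees
  never increase along \<open>rides\<close>.\<close>

definition candidates :: "nat \<Rightarrow> (nat \<Rightarrow> nat) \<Rightarrow> nat \<Rightarrow> nat set" where
  "candidates b D i = {j. rides i j \<and> j \<noteq> i \<and> free D j \<and> deg j < deg i + b}"

definition board :: "(nat \<Rightarrow> nat) \<Rightarrow> nat \<Rightarrow> nat set \<Rightarrow> nat \<Rightarrow> nat" where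
  "board D i T j = (if j \<in> T then i else D j)"

text \<open>
  Loads of \<open>i\<close> are compared only with what is left over, so that each passenger taken pays for
  at most one trip that an optimal solution assigns to \<open>i\<close> and that travels alone here.
\<close>

definition sated :: "nat \<Rightarrow> nat set \<Rightarrow> nat set \<Rightarrow> bool" where
  "sated i C T \<longleftrightarrow> T \<subseteq> C \<and> feas i T \<and> (\<forall>X\<subseteq>C - T. feas i X \<longrightarrow> card X \<le> card T)"

text \<open>Trips that have boarded are no longer candidates, so this is the comparison of
  \<open>sated\<close> phrased for an assignment alone. It persists under \<open>extends\<close>,
  where candidates disappear and loads grow.\<close>

definition settled :: "nat \<Rightarrow> (nat \<Rightarrow> nat) \<Rightarrow> nat \<Rightarrow> bool" where
  "settled b D i \<longleftrightarrow> (\<forall>X\<subseteq>candidates b D i. feas i X \<longrightarrow> card X \<le> card (passengers D i))"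

definition extends :: "(nat \<Rightarrow> nat) \<Rightarrow> (nat \<Rightarrow> nat) \<Rightarrow> bool" where
  "extends D D' \<longleftrightarrow> (\<forall>j. free D' j \<longrightarrow> free D j) \<and> (\<forall>j. passengers D j \<subseteq> passengers D' j)"

lemma passengers_finite [simp]: "finite (passengers D i)"
  by (simp add: passengers_def)

lemma candidates_subset: "candidates b D i \<subseteq> {..<l}"
  by (auto simp: candidates_def rides_iff)

lemma candidates_finite [simp]: "finite (candidates b D i)"
  by (rule finite_subset[OF candidates_subset]) simp

lemma extends_refl: "extends D D"
  and extends_trans: "extends D D' \<Longrightarrow> extends D' D'' \<Longrightarrow> extends D D''"
  unfolding extends_def by (simp, meson order_trans)

lemma candidates_extends: "extends D D' \<Longrightarrow> candidates b D' i \<subseteq> candidates b D i"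
  by (auto simp: extends_def candidates_def)

lemma settled_extends:
  assumes "extends D D'" "settled b D i"
  shows "settled b D' i"
proof -
  have "card (passengers D i) \<le> card (passengers D' i)"
    using assms(1) by (intro card_mono) (auto simp: extends_def)
  then show ?thesis
    using assms candidates_extends[OF assms(1), of b i]
    unfolding settled_def by (meson order_trans)
qed

text \<open>The members of \<open>T\<close> were passengers of nobody, so no other driver loses
  any.\<close>

lemma passengers_board:
  assumes "free D i" "T \<subseteq> candidates b D i"
  shows "passengers (board D i T) k = (if k = i then T else passengers D k)"
proof -
  have T: "j < l \<and> j \<noteq> i \<and> D j = j" if "j \<in> T" for j
    using assms that by (auto simp: candidates_def free_def rides_iff)
  show ?thesis
    using assms T by (auto simp: passengers_def board_def free_def split: if_splits)
qed

lemma free_board: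
  assumes "free D i" "T \<subseteq> candidates b D i" "free (board D i T) j"
  shows "free D j" "j \<notin> T"
proof -
  have "j = i" if "j \<in> T"
    using that assms by (auto simp: free_def board_def)
  then show "j \<notin> T" using assms by (auto simp: candidates_def)
  then show "free D j"
    using assms passengers_board[OF assms(1,2), of j]
    by (auto simp: free_def board_def split: if_splits)
qed

lemma free_board_other:
  assumes "free D i" "T \<subseteq> candidates b D i" "free D j" "j \<notin> T" "j \<noteq> i"
  shows "free (board D i T) j"
  using assms passengers_board[OF assms(1,2), of j] by (simp add: free_def board_def)

lemma extends_board:
  assumes "free D i" "T \<subseteq> candidates b D i"
  shows "extends D (board D i T)"
  using assms free_board[OF assms] passengers_board[OF assms]
  by (auto simp: extends_def) (auto simp: free_def)

lemma valid_board:
  assumes "valid D" "i < l" "free D i" "T \<subseteq> candidates b D i" "feas i T"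
  shows "valid (board D i T)"
  unfolding valid_def
proof (intro allI impI)
  fix k assume k: "k < l"
  have i: "i \<notin> T" "D i = i" using assms by (auto simp: candidates_def free_def)
  \<comment> \<open>The driver of somebody else never becomes a passenger, since candidates have no
    passengers.\<close>
  have "D k \<notin> T" if "k \<notin> T"
  proof
    assume T: "D k \<in> T"
    then have "passengers D (D k) = {}" using assms by (auto simp: candidates_def free_def)
    moreover have "k \<noteq> D k" using T that by auto
    ultimately show False using k by (auto simp: passengers_def)
  qed
  then show "board D i T k < l \<and> board D i T (board D i T k) = board D i T k \<and>
      feas k (passengers (board D i T) k)"
    using assms k i passengers_board[OF assms(3,4), of k]
    by (auto simp: board_def valid_def)
qed

lemma settled_board:
  assumes "free D i" "sated i (candidates b D i) T"
  shows "settled b (board D i T) i"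
proof -
  have T: "T \<subseteq> candidates b D i" using assms by (simp add: sated_def)
  have "candidates b (board D i T) i \<subseteq> candidates b D i - T"
    using free_board[OF assms(1) T] by (auto simp: candidates_def)
  then show ?thesis
    using assms passengers_board[OF assms(1) T, of i]
    unfolding settled_def sated_def by (metis order_trans)
qed

lemma valid_id: "valid (\<lambda>j. j)" and free_id: "free (\<lambda>j. j) j"
  by (auto simp: valid_def free_def passengers_def feasible_load_def)

section \<open>Greedy loads and the charging argument\<close>

text \<open>\<open>S\<close> stands for the sources at which \<open>i\<close> has made a stop.\<close>

lemma greedy_sated:
  assumes C: "C \<subseteq> {..<l}" and T: "T \<subseteq> C" "feas i T"
    and S: "finite S" "src i \<notin> S"
    and dom: "\<And>v w. v \<in> S \<Longrightarrow> w \<notin> insert (src i) S \<Longrightarrow>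
      card {j \<in> C. src j = w} \<le> card {j \<in> C. src j = v}"
    and stop: "card T = cap i \<or> (\<forall>j\<in>C - T. src j \<notin> insert (src i) S \<and> card S = stp i)"
  shows "sated i C T"
  unfolding sated_def
proof (intro conjI allI impI T)
  fix X assume X: "X \<subseteq> C - T" "feas i X"
  let ?g = "\<lambda>v. card {j \<in> C. src j = v}"
  have fin: "finite C" "finite X" "finite T"
    using C X(1) T(1) finite_subset[of _ "{..<l}"] by (auto intro: finite_subset)
  show "card X \<le> card T"
  \<comment> \<open>A full vehicle cannot be beaten, so counting is left to the case where the stops
    have run out.\<close>
  proof (cases "card T = cap i \<or> X = {}")
    case True
    then show ?thesis using X by (auto simp: feasible_load_def)
  next
    case False
    then have out: "\<And>j. j \<in> C - T \<Longrightarrow> src j \<notin> insert (src i) S" and full: "card S = stp i"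
      using stop X by auto
    have "src ` X - {src i} = src ` X" using out X by auto
    then have "card (src ` X) \<le> stp i" using X by (simp add: feasible_load_def)
    then have XS: "card (src ` X) \<le> card S" using full by simp
    have "X \<noteq> {}" using False by simp
    then have "S \<noteq> {}" using XS fin S by auto
    \<comment> \<open>\<open>m\<close> is the size of the smallest group of candidates at a source
      in \<open>S\<close>. Sources outside offer at most \<open>m\<close> each, those in
      \<open>S\<close> at least \<open>m\<close>, and \<open>X\<close> uses no more sources than
      \<open>S\<close> has.\<close>
    define m where "m = Min (?g ` S)"
    have m: "?g w \<le> m" if "w \<notin> insert (src i) S" for w
      unfolding m_def using dom that S(1) \<open>S \<noteq> {}\<close> by (subst Min_ge_iff) auto
    have "card X \<le> (\<Sum>w\<in>src ` X. card {j \<in> X. src j = w})"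
    proof -
      have "(\<Union>w\<in>src ` X. {j \<in> X. src j = w}) = X" by auto
      then show ?thesis
        using card_UN_le[of "src ` X" "\<lambda>w. {j \<in> X. src j = w}"] fin(2) by simp
    qed
    also have "\<dots> \<le> (\<Sum>w\<in>src ` X. m)"
    proof (rule sum_mono)
      fix w assume w: "w \<in> src ` X"
      have "card {j \<in> X. src j = w} \<le> ?g w" using X fin by (intro card_mono) auto
      also have "\<dots> \<le> m" using w X out by (intro m) auto
      finally show "card {j \<in> X. src j = w} \<le> m" .
    qed
    also have "\<dots> \<le> (\<Sum>v\<in>S. m)" using XS by simp
    also have "\<dots> \<le> (\<Sum>v\<in>S. ?g v)" unfolding m_def using S by (intro sum_mono Min_le) auto
    also have "\<dots> = card (\<Union>v\<in>S. {j \<in> C. src j = v})"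
      using S fin by (intro card_UN_disjoint[symmetric]) auto
    \<comment> \<open>No candidate outside \<open>T\<close> has its source in \<open>S\<close>, so
      these groups lie inside \<open>T\<close>.\<close>
    also have "\<dots> \<le> card T"
      using out fin by (intro card_mono) auto
    finally show ?thesis .
  qed
qed

text \<open>Bounds the lonely trips charged to \<open>i\<close>. If \<open>i\<close> is free there
  are none; if all have smaller degree, \<open>settled\<close> suffices. Otherwise there is just
  one, paid for by a passenger of \<open>i\<close> or, if \<open>i\<close> is a passenger itself, by
  the summand 1.\<close>

lemma served_bound:
  assumes D: "valid D" and settled: "\<And>i. i < l \<Longrightarrow> settled 0 D i"
    and maximal: "\<And>i. i < l \<Longrightarrow> free D i \<Longrightarrow> candidates 1 D i = {}"
    and i: "i < l" and A: "feas i A" "\<And>j. j \<in> A \<Longrightarrow> free D j \<and> j \<noteq> i"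
  shows "card A \<le> card (passengers D i) + (if D i = i then 0 else 1)"
proof (cases "free D i")
  case True
  have "A \<subseteq> candidates 1 D i"
    using A feas_rides[OF A(1)] rides_deg_le[OF i] by (fastforce simp: candidates_def)
  then show ?thesis using maximal[OF i True] by simp
next
  case nf: False
  show ?thesis
  proof (cases "\<forall>j\<in>A. deg j < deg i")
    case True
    then have "A \<subseteq> candidates 0 D i"
      using A feas_rides[OF A(1)] by (auto simp: candidates_def)
    then show ?thesis using settled[OF i] A by (auto simp: settled_def)
  next
    case False
    then obtain j where j: "j \<in> A" "deg j = deg i"
      using feas_rides[OF A(1)] rides_deg_le[OF i] by (meson le_neq_implies_less)
    have jl: "j < l" using feas_rides[OF A(1) j(1)] by (simp add: rides_iff)
    \<comment> \<open>By \<open>rides_deg_eq\<close> the free trip \<open>j\<close> could take any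
      other member \<open>k\<close>, against \<open>maximal\<close>.\<close>
    have "k = j" if k: "k \<in> A" for k
    proof (rule ccontr)
      assume "k \<noteq> j"
      have "rides j k" using rides_deg_eq[OF i] feas_rides[OF A(1)] j k by blast
      then have "k \<in> candidates 1 D j"
        using rides_deg_le[OF jl] A(2)[OF k] \<open>k \<noteq> j\<close> by (fastforce simp: candidates_def)
      then show False using maximal[OF jl] A(2)[OF j(1)] by auto
    qed
    then have "A \<subseteq> {j}" by auto
    then have "card A \<le> 1" using card_mono[of "{j}" A] by simp
    moreover have "0 < card (passengers D i)" if "D i = i"
      using nf that by (simp add: free_def card_gt_0_iff)
    ultimately show ?thesis by auto
  qed
qed

lemma sum_passengers:
  assumes "valid D"
  shows "(\<Sum>i<l. card (passengers D i)) = card {j. j < l \<and> D j \<noteq> j}"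
proof -
  have "(\<Sum>i<l. card (passengers D i)) = card (\<Union>i<l. passengers D i)"
    by (intro card_UN_disjoint[symmetric]) (auto simp: passengers_def)
  also have "(\<Union>i<l. passengers D i) = {j. j < l \<and> D j \<noteq> j}"
  proof (intro subset_antisym subsetI)
    fix j assume "j \<in> {j. j < l \<and> D j \<noteq> j}"
    then have "j \<in> passengers D (D j)" "D j < l"
      using assms by (simp_all add: passengers_def valid_def)
    then show "j \<in> (\<Union>i<l. passengers D i)" by blast
  next
    fix j assume "j \<in> (\<Union>i<l. passengers D i)"
    then obtain i where "j \<in> passengers D i" by blast
    then show "j \<in> {j. j < l \<and> D j \<noteq> j}" by (simp add: passengers_def)
  qed
  finally show ?thesis .
qed

text \<open>Trips outside \<open>S\<close> are passengers of \<open>D\<close>, drivers with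
  passengers, or free. A passenger pays at most twice: as part of a load, and directly, for itself
  when outside \<open>S\<close> and for one free trip when in \<open>S\<close>.\<close>

lemma passenger_bound:
  assumes D: "valid D" and settled: "\<And>i. i < l \<Longrightarrow> settled 0 D i"
    and maximal: "\<And>i. i < l \<Longrightarrow> free D i \<Longrightarrow> candidates 1 D i = {}"
    and sol: "is_solution I S \<sigma>"
  shows "l \<le> card S + 2 * card {j. j < l \<and> D j \<noteq> j}"
proof -
  let ?P = "{j. j < l \<and> D j \<noteq> j}"
  let ?F = "{j. j < l \<and> free D j}"
  let ?B = "{j. j < l \<and> D j = j \<and> passengers D j \<noteq> {}}"
  let ?w = "\<lambda>i. card (passengers D i)"
  have S: "S \<subseteq> {..<l}" and serve: "\<And>i. i \<in> S \<Longrightarrow> can_serve_set I i (\<sigma> i)"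
    and cover: "(\<Union>i\<in>S. \<sigma> i) = {..<l}"
    using sol by (auto simp: is_solution_def)
  have finS: "finite S" using S finite_subset by blast
  have x: "card (\<sigma> i \<inter> ?F - {i}) \<le> ?w i + (if i \<in> ?P then 1 else 0)" if i: "i \<in> S" for i
  proof -
    have il: "i < l" using i S by auto
    have "feas i (\<sigma> i - {i})" using serve[OF i] can_serve_set_iff[OF il] by simp
    then have "feas i (\<sigma> i \<inter> ?F - {i})" by (rule feas_subset) auto
    with D settled maximal il
    have "card (\<sigma> i \<inter> ?F - {i}) \<le> ?w i + (if D i = i then 0 else 1)"
      by (rule served_bound) auto
    then show ?thesis using il by (cases "D i = i") simp_all
  qed
  have "{..<l} - S \<subseteq> (?P - S) \<union> (?B - S) \<union> (\<Union>i\<in>S. \<sigma> i \<inter> ?F - {i})"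
  proof
    fix j assume j: "j \<in> {..<l} - S"
    then obtain i where "i \<in> S" "j \<in> \<sigma> i" using cover by blast
    then show "j \<in> (?P - S) \<union> (?B - S) \<union> (\<Union>i\<in>S. \<sigma> i \<inter> ?F - {i})"
      using j by (auto simp: free_def)
  qed
  then have "card ({..<l} - S) \<le> card ((?P - S) \<union> (?B - S) \<union> (\<Union>i\<in>S. \<sigma> i \<inter> ?F - {i}))"
    using finS by (intro card_mono) auto
  also have "\<dots> \<le> card (?P - S) + card (?B - S) + card (\<Union>i\<in>S. \<sigma> i \<inter> ?F - {i})"
    by (meson add_le_mono card_Un_le le_refl order_trans)
  also have "card (\<Union>i\<in>S. \<sigma> i \<inter> ?F - {i}) \<le> (\<Sum>i\<in>S. card (\<sigma> i \<inter> ?F - {i}))"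
    using finS by (rule card_UN_le)
  also have "\<dots> \<le> (\<Sum>i\<in>S. ?w i + (if i \<in> ?P then 1 else 0))"
    using x by (rule sum_mono)
  also have "\<dots> = (\<Sum>i\<in>S. ?w i) + card (?P \<inter> S)"
    using finS by (simp only: sum.distrib sum.If_cases) (simp add: Int_commute)
  also have "card (?B - S) \<le> (\<Sum>i\<in>?B - S. ?w i)"
    using sum_mono[of "?B - S" "\<lambda>_. 1" ?w] by (auto simp: Suc_le_eq card_gt_0_iff)
  also have "(\<Sum>i\<in>?B - S. ?w i) \<le> (\<Sum>i\<in>{..<l} - S. ?w i)"
    by (intro sum_mono2) auto
  \<comment> \<open>The first bracket counts each passenger once, according to membership in
    \<open>S\<close>; the second adds up all loads and counts each once more.\<close>
  finally have "card ({..<l} - S) \<le> (card (?P - S) + card (?P \<inter> S)) +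
      ((\<Sum>i\<in>{..<l} - S. ?w i) + (\<Sum>i\<in>S. ?w i))" by simp
  also have "(\<Sum>i\<in>{..<l} - S. ?w i) + (\<Sum>i\<in>S. ?w i) = card ?P"
    using sum.subset_diff[OF S, of ?w] sum_passengers[OF D] by simp
  also have "card (?P - S) + card (?P \<inter> S) = card ?P"
    by (simp add: card_Diff_subset_Int Int_commute card_mono)
  finally have "card ({..<l} - S) \<le> 2 * card ?P" by simp
  then show ?thesis using card_Diff_subset[OF finS S] by simp
qed

lemma is_solution_drivers:
  assumes "valid D"
  shows "is_solution I {i. i < l \<and> D i = i} (\<lambda>i. {j. j < l \<and> D j = i})"
  unfolding is_solution_def
proof (intro conjI ballI)
  fix i assume i: "i \<in> {i. i < l \<and> D i = i}"
  then have "{j. j < l \<and> D j = i} - {i} = passengers D i" by (auto simp: passengers_def)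
  then show "can_serve_set I i {j. j < l \<and> D j = i}"
    using assms i by (auto simp: can_serve_set_iff valid_def)
qed (use assms in \<open>auto simp: disjoint_family_on_def valid_def\<close>)

text \<open>The maximum is compared only with capacities of members of \<open>S\<close>. This covers
  the instance without trips, where it is taken over the empty set.\<close>

lemma solution_card_ge:
  assumes sol: "is_solution I S \<sigma>"
  shows "l \<le> (Max (capacity ` set (trips I)) + 1) * card S"
proof -
  have S: "S \<subseteq> {..<l}" and cover: "(\<Union>i\<in>S. \<sigma> i) = {..<l}"
    using sol by (auto simp: is_solution_def)
  have finS: "finite S" using S finite_subset by blast
  have "l = card (\<Union>i\<in>S. \<sigma> i)" using cover by simp
  also have "\<dots> \<le> (\<Sum>i\<in>S. card (\<sigma> i))" using finS by (rule card_UN_le)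
  also have "\<dots> \<le> (\<Sum>i\<in>S. Max (capacity ` set (trips I)) + 1)"
  proof (rule sum_mono)
    fix i assume i: "i \<in> S"
    then have "card (\<sigma> i) \<le> cap i + 1"
      using sol by (auto simp: is_solution_def can_serve_set_def)
    moreover have "cap i \<le> Max (capacity ` set (trips I))"
      using i S by (intro Max_ge) auto
    ultimately show "card (\<sigma> i) \<le> Max (capacity ` set (trips I)) + 1" by simp
  qed
  finally show ?thesis by (simp add: mult.commute)
qed

lemma approximation:
  assumes D: "valid D" and settled: "\<And>i. i < l \<Longrightarrow> settled 0 D i"
    and maximal: "\<And>i. i < l \<Longrightarrow> free D i \<Longrightarrow> candidates 1 D i = {}"
    and sol: "is_solution I S \<sigma>"
  shows "real (card {i. i < l \<and> D i = i}) \<le>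
    (real (Max (capacity ` set (trips I))) + 2) / 2 * real (card S)"
proof -
  let ?K = "Max (capacity ` set (trips I))"
  have "card {i. i < l \<and> D i = i} + card {i. i < l \<and> D i \<noteq> i} = card {..<l}"
    by (subst card_Un_disjoint[symmetric]) (auto intro!: arg_cong[of _ "{..<l}" card] simp del: card_lessThan)
  then have "2 * card {i. i < l \<and> D i = i} \<le> l + card S"
    using passenger_bound[OF assms] by simp
  also have "\<dots> \<le> (?K + 2) * card S"
    using solution_card_ge[OF sol] by simp
  finally have "real (2 * card {i. i < l \<and> D i = i}) \<le> real ((?K + 2) * card S)"
    by (simp only: of_nat_le_iff)
  then show ?thesis by (simp add: algebra_simps)
qed

end

section \<open>Reasoning about programs and their running time\<close>

text \<open>A total correctness precondition whose postcondition also receives the number of steps.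
  The equations below let the simplifier evaluate it on loop-free integer code.\<close>

definition runs :: "prog \<Rightarrow> state \<Rightarrow> (nat \<Rightarrow> state \<Rightarrow> bool) \<Rightarrow> bool" where
  "runs p s Q \<longleftrightarrow> (\<exists>n s'. exec p s n s' \<and> Q n s')"

lemma runs_Skip [simp]: "runs Skip s Q \<longleftrightarrow> Q 1 s"
  unfolding runs_def by (metis Skip_elim exec.Skip)

lemma runs_IAssign [simp]:
  "runs (IAssign x e) s Q \<longleftrightarrow> Q 1 (s\<lparr>ivar := (ivar s)(x := ival e s)\<rparr>)"
  unfolding runs_def by (metis IAssign_elim exec.IAssign)

lemma runs_IUpdate [simp]:
  "runs (IUpdate a e f) s Q \<longleftrightarrow>
     Q 1 (s\<lparr>iarr := (iarr s)(a := (iarr s a)(ival e s := ival f s))\<rparr>)"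
  unfolding runs_def by (metis IUpdate_elim exec.IUpdate)

lemma runs_Seq [simp]:
  "runs (Seq p q) s Q \<longleftrightarrow> runs p s (\<lambda>m s'. runs q s' (\<lambda>n. Q (m + n)))"
  unfolding runs_def by (blast elim: Seq_elim intro: exec.Seq)

lemma runs_Cond [simp]:
  "runs (Cond b p q) s Q \<longleftrightarrow> runs (if tval b s then p else q) s (\<lambda>n. Q (Suc n))"
proof (cases "tval b s")
  case True
  then have "exec (Cond b p q) s n s' \<longleftrightarrow> (\<exists>m. n = Suc m \<and> exec p s m s')" for n s'
    using exec.CondT[OF True, of p _ s' q] by (auto elim: Cond_elim)
  then show ?thesis using True unfolding runs_def by auto
next
  case False
  then have "exec (Cond b p q) s n s' \<longleftrightarrow> (\<exists>m. n = Suc m \<and> exec q s m s')" for n s'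
    using exec.CondF[OF False, of q _ s' p] by (auto elim: Cond_elim)
  then show ?thesis using False unfolding runs_def by auto
qed

lemma runs_mono:
  assumes "runs p s Q" "\<And>n s'. Q n s' \<Longrightarrow> Q' n s'"
  shows "runs p s Q'"
  using assms by (auto simp: runs_def)

lemma runs_WhileF: "\<not> tval b s \<Longrightarrow> Q 1 s \<Longrightarrow> runs (While b p) s Q"
  unfolding runs_def by (metis exec.WhileF)

lemma runs_WhileT:
  assumes "tval b s" "runs p s (\<lambda>m s'. runs (While b p) s' (\<lambda>n. Q (Suc (m + n))))"
  shows "runs (While b p) s Q"
  using assms unfolding runs_def by (metis exec.WhileT plus_1_eq_Suc add_Suc)

text \<open>A syntactic bound on what a program can change, which keeps invariants short. Writes to
  reals are left out, as \<open>frame\<close> claims nothing about them.\<close>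

fun assigned :: "prog \<Rightarrow> string set" where
  "assigned (IAssign x e) = {x}"
| "assigned (Seq p q) = assigned p \<union> assigned q"
| "assigned (Cond b p q) = assigned p \<union> assigned q"
| "assigned (While b p) = assigned p"
| "assigned _ = {}"

fun updated :: "prog \<Rightarrow> string set" where
  "updated (IUpdate a e f) = {a}"
| "updated (Seq p q) = updated p \<union> updated q"
| "updated (Cond b p q) = updated p \<union> updated q"
| "updated (While b p) = updated p"
| "updated _ = {}"

definition frame :: "string set \<Rightarrow> string set \<Rightarrow> state \<Rightarrow> state \<Rightarrow> bool" where
  "frame X A s s' \<longleftrightarrow>
     (\<forall>x. x \<notin> X \<longrightarrow> ivar s' x = ivar s x) \<and> (\<forall>a. a \<notin> A \<longrightarrow> iarr s' a = iarr s a)"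

lemma exec_frame: "exec p s n s' \<Longrightarrow> frame (assigned p) (updated p) s s'"
  by (induction rule: exec.induct) (auto simp: frame_def)

lemma frame_refl: "frame X A s s"
  and frame_trans: "frame X A s s' \<Longrightarrow> frame X A s' s'' \<Longrightarrow> frame X A s s''"
  by (auto simp: frame_def)

lemma runs_frame:
  assumes "runs p s Q"
    and "\<And>n s'. Q n s' \<Longrightarrow> frame (assigned p) (updated p) s s' \<Longrightarrow> Q' n s'"
  shows "runs p s Q'"
  using assms exec_frame unfolding runs_def by metis

text \<open>The invariant carries the elapsed time: \<open>Suc\<close> is the price of a test, in
  each round and once more at the exit. The measure \<open>m\<close> gives termination, and the
  frame always refers to the state before the loop.\<close>

lemma runs_While:
  fixes m :: "state \<Rightarrow> nat"
  assumes start: "Inv 0 s"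
    and step: "\<And>t s'. Inv t s' \<Longrightarrow> frame (assigned p) (updated p) s s' \<Longrightarrow> tval b s' \<Longrightarrow>
      runs p s' (\<lambda>n s''. Inv (Suc (t + n)) s'' \<and> m s'' < m s')"
    and exit: "\<And>t s'. Inv t s' \<Longrightarrow> frame (assigned p) (updated p) s s' \<Longrightarrow> \<not> tval b s' \<Longrightarrow>
      Q (Suc t) s'"
  shows "runs (While b p) s Q"
proof -
  have "runs (While b p) s' (\<lambda>n. Q (t + n))"
    if "Inv t s'" "frame (assigned p) (updated p) s s'" for t s'
    using that
  proof (induction "m s'" arbitrary: t s' rule: less_induct)
    case less
    show ?case
    proof (cases "tval b s'")
      case False
      then show ?thesis using exit[OF less.prems] by (intro runs_WhileF) auto
    next
      case True
      have "runs (While b p) s'' (\<lambda>k. Q (t + Suc (n + k)))"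
        if "Inv (Suc (t + n)) s'' \<and> m s'' < m s'" "frame (assigned p) (updated p) s' s''" for n s''
        using less.hyps[of s'' "Suc (t + n)"] that frame_trans[OF less.prems(2) that(2)]
        by (simp add: add.assoc)
      then show ?thesis
        by (intro runs_WhileT[OF True] runs_frame[OF step[OF less.prems True]]) auto
    qed
  qed
  from this[OF start frame_refl] show ?thesis by simp
qed

definition For :: "string \<Rightarrow> iexp \<Rightarrow> iexp \<Rightarrow> prog \<Rightarrow> prog" where
  "For x a e p = Seq (IAssign x a)
     (While (ILess (IVar x) e) (Seq p (IAssign x (IAdd (IVar x) (IConst 1)))))"

lemma assigned_For [simp]: "assigned (For x a e p) = insert x (assigned p)"
  and updated_For [simp]: "updated (For x a e p) = updated p"
  by (auto simp: For_def)

text \<open>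
  The invariant may be falsified by the update of the counter \<open>x\<close>, so that \<open>step\<close> and \<open>start\<close>
  ask for it after this update.
\<close>

lemma runs_For:
  assumes lo: "ival a s = int lo" and le: "lo \<le> hi"
    and fresh: "x \<notin> assigned p"
    and hi: "\<And>s'. frame (insert x (assigned p)) (updated p) s s' \<Longrightarrow> ival e s' = int hi"
    and start: "Inv lo 1 (s\<lparr>ivar := (ivar s)(x := int lo)\<rparr>)"
    and step: "\<And>k t s'. lo \<le> k \<Longrightarrow> k < hi \<Longrightarrow> Inv k t s' \<Longrightarrow> ivar s' x = int k \<Longrightarrow>
      frame (insert x (assigned p)) (updated p) s s' \<Longrightarrow>
      runs p s' (\<lambda>n s''. Inv (Suc k) (t + n + 2) (s''\<lparr>ivar := (ivar s'')(x := int k + 1)\<rparr>))"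
    and exit: "\<And>t s'. Inv hi t s' \<Longrightarrow>
      frame (insert x (assigned p)) (updated p) s s' \<Longrightarrow> Q (Suc t) s'"
  shows "runs (For x a e p) s Q"
proof -
  let ?s = "s\<lparr>ivar := (ivar s)(x := int lo)\<rparr>"
  let ?X = "insert x (assigned p)"
  have f0: "frame ?X (updated p) s ?s" by (auto simp: frame_def)
  have "runs (While (ILess (IVar x) e) (Seq p (IAssign x (IAdd (IVar x) (IConst 1))))) ?s
      (\<lambda>n. Q (1 + n))"
  \<comment> \<open>\<open>Suc t\<close> accounts for the initial assignment to the counter.\<close>
  proof (rule runs_While[where
        Inv = "\<lambda>t s'. \<exists>k. lo \<le> k \<and> k \<le> hi \<and> ivar s' x = int k \<and> Inv k (Suc t) s'" and
        m = "\<lambda>s'. nat (int hi - ivar s' x)"], goal_cases)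
    case 1
    then show ?case using le start by auto
  next
    case (2 t s')
    then obtain k where k: "lo \<le> k" "k \<le> hi" "ivar s' x = int k" "Inv k (Suc t) s'" by blast
    have "frame ?X (updated p) ?s s'" using 2(2) by simp
    then have f: "frame ?X (updated p) s s'" by (rule frame_trans[OF f0])
    then have "k < hi" using 2(3) hi k by simp
    show ?case
      using fresh \<open>k < hi\<close> k
      by (auto simp: frame_def intro!: exI[of _ "Suc k"]
          intro: runs_frame[OF step[OF k(1) \<open>k < hi\<close> k(4,3) f]])
  next
    case (3 t s')
    then obtain k where k: "lo \<le> k" "k \<le> hi" "ivar s' x = int k" "Inv k (Suc t) s'" by blast
    have "frame ?X (updated p) ?s s'" using 3(2) by simp
    then have f: "frame ?X (updated p) s s'" by (rule frame_trans[OF f0])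
    then have "k = hi" using 3(3) hi k by simp
    then show ?case using exit[of "Suc t" s'] k f by simp
  qed
  then show ?thesis by (simp add: For_def lo)
qed

abbreviation IEq :: "iexp \<Rightarrow> iexp \<Rightarrow> test" where
  "IEq e f \<equiv> TAnd (TNot (ILess e f)) (TNot (ILess f e))"

section \<open>The program\<close>

abbreviation zero :: iexp where "zero \<equiv> IConst 0"
abbreviation one :: iexp where "one \<equiv> IConst 1"

text \<open>
  Column \<open>j\<close> of row \<open>i\<close> of the matrix \<open>adj\<close> is entry \<open>row[i] + j\<close>. A vertex is on the route of
  \<open>i\<close> if its mark is \<open>i + 1\<close>, so that the marks need not be erased between trips.
\<close>

definition mark_route :: prog where
  "mark_route = For ''k'' (IArr ''vertstart'' (IVar ''i''))
     (IArr ''vertstart'' (IAdd (IVar ''i'') one))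
     (IUpdate ''mark'' (IArr ''pathvert'' (IVar ''k'')) (IAdd (IVar ''i'') one))"

text \<open>The nested negations at the end express a disjunction.\<close>

definition rides_test :: test where
  "rides_test =
     TAnd (ILess zero (IArr ''capacity'' (IVar ''i'')))
    (TAnd (IEq (IArr ''mark'' (IArr ''source'' (IVar ''j''))) (IAdd (IVar ''i'') one))
    (TAnd (IEq (IArr ''mark'' (IArr ''dest'' (IVar ''j''))) (IAdd (IVar ''i'') one))
       (TNot (TAnd
         (TNot (IEq (IArr ''source'' (IVar ''j'')) (IArr ''source'' (IVar ''i''))))
         (TNot (ILess zero (IArr ''stops'' (IVar ''i''))))))))"

definition fill_row :: prog where
  "fill_row = For ''j'' zero (IVar ''ntrips'') (Cond rides_test
     (Seq (IUpdate ''adj'' (IAdd (IArr ''row'' (IVar ''i'')) (IVar ''j'')) one)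
       (IUpdate ''deg'' (IVar ''i'') (IAdd (IArr ''deg'' (IVar ''i'')) one)))
     Skip)"

text \<open>There is no multiplication, so the row starts are accumulated by addition.\<close>

definition setup_prog :: prog where
  "setup_prog = For ''i'' zero (IVar ''ntrips'')
     (Seq mark_route (Seq fill_row
       (Seq (IUpdate ''driver'' (IVar ''i'') (IVar ''i''))
         (IUpdate ''row'' (IAdd (IVar ''i'') one)
           (IAdd (IArr ''row'' (IVar ''i'')) (IVar ''ntrips''))))))"

definition candidate_test :: "nat \<Rightarrow> test" where
  "candidate_test b =
     TAnd (ILess zero (IArr ''adj'' (IAdd (IArr ''row'' (IVar ''i'')) (IVar ''j''))))
    (TAnd (TNot (IEq (IVar ''j'') (IVar ''i'')))
    (TAnd (IEq (IArr ''driver'' (IVar ''j'')) (IVar ''j''))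
    (TAnd (ILess (IArr ''load'' (IVar ''j'')) one)
       (ILess (IArr ''deg'' (IVar ''j'')) (IAdd (IArr ''deg'' (IVar ''i'')) (IConst (int b)))))))"

text \<open>
  \<open>cnt[v]\<close> is the number of candidates at source \<open>v\<close>, and \<open>ntrips + 1\<close> if \<open>v\<close> can be used without
  a further stop.
\<close>

abbreviation source_count :: "iexp \<Rightarrow> iexp" where
  "source_count j \<equiv> IArr ''cnt'' (IArr ''source'' j)"

text \<open>Resetting only the entries at sources of trips keeps the time linear in
  \<open>ntrips\<close>, whatever the number of vertices.\<close>

definition clear_counts :: prog where
  "clear_counts = For ''j'' zero (IVar ''ntrips'')
     (IUpdate ''cnt'' (IArr ''source'' (IVar ''j'')) zero)"

definition count_candidates :: "nat \<Rightarrow> prog" where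
  "count_candidates b = For ''j'' zero (IVar ''ntrips'') (Cond (candidate_test b)
     (IUpdate ''cnt'' (IArr ''source'' (IVar ''j'')) (IAdd (source_count (IVar ''j'')) one))
     Skip)"

text \<open>Opened sources carry \<open>ntrips + 1\<close>, more than any true count, so they are
  exhausted before a further stop is spent. Candidates have positive counts, so a final
  \<open>best\<close> of 0 means that nobody can be taken.\<close>

definition scan :: "nat \<Rightarrow> prog" where
  "scan b = Seq (IAssign ''best'' zero)
     (For ''j'' zero (IVar ''ntrips'') (Cond
       (TAnd (candidate_test b)
         (TAnd (ILess (IVar ''best'') (source_count (IVar ''j'')))
           (TNot (TAnd
             (TNot (ILess (IVar ''ntrips'') (source_count (IVar ''j''))))
             (TNot (ILess (IVar ''used'') (IArr ''stops'' (IVar ''i''))))))))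
       (Seq (IAssign ''best'' (source_count (IVar ''j''))) (IAssign ''pick'' (IVar ''j'')))
       Skip))"

definition take_pick :: prog where
  "take_pick = Seq
     (Cond (ILess (IVar ''ntrips'') (source_count (IVar ''pick'')))
       Skip
       (Seq (IUpdate ''cnt'' (IArr ''source'' (IVar ''pick'')) (IAdd (IVar ''ntrips'') one))
         (IAssign ''used'' (IAdd (IVar ''used'') one))))
     (Seq (IUpdate ''driver'' (IVar ''pick'') (IVar ''i''))
       (IUpdate ''load'' (IVar ''i'') (IAdd (IArr ''load'' (IVar ''i'')) one)))"

definition take_loop :: "nat \<Rightarrow> prog" where
  "take_loop b = While
     (TAnd (ILess zero (IVar ''best''))
       (ILess (IArr ''load'' (IVar ''i'')) (IArr ''capacity'' (IVar ''i''))))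
     (Seq take_pick (scan b))"

text \<open>The source of \<open>i\<close> is marked as opened beforehand, since boarding there is
  not a stop.\<close>

definition fill_vehicle :: "nat \<Rightarrow> prog" where
  "fill_vehicle b =
     Seq clear_counts (Seq (count_candidates b)
    (Seq (IUpdate ''cnt'' (IArr ''source'' (IVar ''i'')) (IAdd (IVar ''ntrips'') one))
    (Seq (IAssign ''used'' zero) (Seq (scan b) (take_loop b)))))"

definition sweep_degree :: "nat \<Rightarrow> prog" where
  "sweep_degree b = For ''i'' zero (IVar ''ntrips'') (Cond
     (TAnd (IEq (IArr ''deg'' (IVar ''i'')) (IVar ''d''))
       (TAnd (IEq (IArr ''driver'' (IVar ''i'')) (IVar ''i''))
         (ILess (IArr ''load'' (IVar ''i'')) one)))
     (fill_vehicle b)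
     Skip)"

text \<open>One pass over all trips for each possible degree from 0 to \<open>ntrips\<close>
  replaces sorting and stays within quadratic time.\<close>

definition sweep :: "nat \<Rightarrow> prog" where
  "sweep b = For ''d'' zero (IAdd (IVar ''ntrips'') one) (sweep_degree b)"

definition ridesharing_prog :: prog where
  "ridesharing_prog = Seq setup_prog (Seq (sweep 0) (sweep 1))"

lemmas prog_defs = mark_route_def fill_row_def clear_counts_def count_candidates_def scan_def
  take_pick_def take_loop_def fill_vehicle_def sweep_degree_def sweep_def

text \<open>Distinct matrix entries occupy distinct cells: quotient and remainder by the row length
  recover row and column.\<close>

lemma row_index_eq:
  fixes a b c d n :: nat
  assumes "b < n" "d < n"
  shows "int a * int n + int b = int c * int n + int d \<longleftrightarrow> a = c \<and> b = d"
proof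
  assume "int a * int n + int b = int c * int n + int d"
  then have "a * n + b = c * n + d"
    by (metis of_nat_add of_nat_eq_iff of_nat_mult)
  then have "(a * n + b) div n = (c * n + d) div n" "(a * n + b) mod n = (c * n + d) mod n"
    by simp_all
  then show "a = c \<and> b = d" using assms by simp
qed simp

subsection \<open>Correctness and running time\<close>

context ridesharing
begin

definition inputs :: "state \<Rightarrow> bool" where
  "inputs s \<longleftrightarrow> ivar s ''ntrips'' = int l \<and>
     (\<forall>j<l. iarr s ''source'' (int j) = int (src j) \<and> iarr s ''dest'' (int j) = int (dst j) \<and>
        iarr s ''capacity'' (int j) = int (cap j) \<and> iarr s ''stops'' (int j) = int (stp j))"

definition offset :: "nat \<Rightarrow> nat" where
  "offset i = length (concat (take i (all_paths I)))"

text \<open>With a single path per trip, path number \<open>i\<close> is the route of trip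
  \<open>i\<close>, so \<open>vertstart\<close> can be indexed by trips.\<close>

definition path_inputs :: "state \<Rightarrow> bool" where
  "path_inputs s \<longleftrightarrow> (\<forall>i<l.
     iarr s ''vertstart'' (int i) = int (offset i) \<and>
     iarr s ''vertstart'' (int i + 1) = int (offset i + length (route I i)) \<and>
     (\<forall>r<length (route I i). iarr s ''pathvert'' (int (offset i + r)) = int (route I i ! r)))"

definition tables :: "state \<Rightarrow> bool" where
  "tables s \<longleftrightarrow> (\<forall>i<l. iarr s ''row'' (int i) = int i * int l \<and>
     iarr s ''deg'' (int i) = int (deg i) \<and>
     (\<forall>j<l. iarr s ''adj'' (int i * int l + int j) = (if rides i j then 1 else 0)))"

definition represents :: "(nat \<Rightarrow> nat) \<Rightarrow> state \<Rightarrow> bool" where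
  "represents D s \<longleftrightarrow> (\<forall>j<l. iarr s ''driver'' (int j) = int (D j) \<and>
     iarr s ''load'' (int j) = int (card (passengers D j)))"

section \<open>Computing the serve relation and the degrees\<close>

lemma mark_route_runs:
  assumes s: "path_inputs s" and i: "i < l" "ivar s ''i'' = int i"
  shows "runs mark_route s (\<lambda>n s'. n \<le> 3 + 3 * length (route I i) \<and>
    (\<forall>v::nat. iarr s' ''mark'' (int v) =
      (if v \<in> set (route I i) then int i + 1 else iarr s ''mark'' (int v))))"
  unfolding mark_route_def
proof (rule runs_For[where lo = "offset i" and hi = "offset i + length (route I i)" and
      Inv = "\<lambda>k t s'. t \<le> 1 + 3 * (k - offset i) \<and> (\<forall>v::nat. iarr s' ''mark'' (int v) =
        (if v \<in> set (take (k - offset i) (route I i)) then int i + 1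
         else iarr s ''mark'' (int v)))"], goal_cases)
  case (6 k t s')
  define r where "r = k - offset i"
  have k: "k = offset i + r" "r < length (route I i)" using 6 by (auto simp: r_def)
  have "iarr s' ''pathvert'' (int k) = int (route I i ! r)"
    using 6(5) s i k by (simp add: frame_def path_inputs_def)
  moreover have "ivar s' ''i'' = int i" using 6(5) i by (simp add: frame_def)
  ultimately show ?case
    using 6 k by (auto simp: take_Suc_conv_app_nth)
qed (use s i in \<open>auto simp: path_inputs_def frame_def\<close>)

lemma rides_test_iff:
  assumes "inputs s" "i < l" "ivar s ''i'' = int i" "j < l" "ivar s ''j'' = int j"
    and "\<forall>v::nat. iarr s ''mark'' (int v) = int i + 1 \<longleftrightarrow> v \<in> set (route I i)"
  shows "tval rides_test s \<longleftrightarrow> rides i j"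
proof -
  have eq: "\<not> x < y \<and> \<not> y < x \<longleftrightarrow> x = y" for x y :: int by auto
  have vals: "iarr s ''capacity'' (int i) = int (cap i)" "iarr s ''source'' (int j) = int (src j)"
    "iarr s ''dest'' (int j) = int (dst j)" "iarr s ''stops'' (int i) = int (stp i)"
    "iarr s ''source'' (int i) = int (src i)"
    using assms(1,2,4) by (simp_all add: inputs_def)
  have marks: "iarr s ''mark'' (int (src j)) = int i + 1 \<longleftrightarrow> src j \<in> set (route I i)"
    "iarr s ''mark'' (int (dst j)) = int i + 1 \<longleftrightarrow> dst j \<in> set (route I i)"
    using assms(6) by blast+
  show ?thesis
    unfolding rides_test_def tval.simps ival.simps assms(3,5) vals eq marks rides_iff
    using assms(4) by auto
qed

lemma fill_row_runs:
  assumes s: "inputs s" and i: "i < l" "ivar s ''i'' = int i"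
    and row: "iarr s ''row'' (int i) = int i * int l" and deg0: "iarr s ''deg'' (int i) = 0"
    and mark: "\<forall>v::nat. iarr s ''mark'' (int v) = int i + 1 \<longleftrightarrow> v \<in> set (route I i)"
  shows "runs fill_row s (\<lambda>n s'. n \<le> 3 + 5 * l \<and>
    (\<forall>a<l. iarr s' ''deg'' (int a) = (if a = i then int (deg i) else iarr s ''deg'' (int a))) \<and>
    (\<forall>a<l. \<forall>b<l. iarr s' ''adj'' (int a * int l + int b) =
      (if a = i \<and> rides i b then 1 else iarr s ''adj'' (int a * int l + int b))))"
  unfolding fill_row_def
proof (rule runs_For[where lo = 0 and hi = l and
      Inv = "\<lambda>k t s'. t \<le> 1 + 5 * k \<and>
    (\<forall>a<l. iarr s' ''deg'' (int a) =
      (if a = i then int (card {j. j < k \<and> rides i j}) else iarr s ''deg'' (int a))) \<and>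
    (\<forall>a<l. \<forall>b<l. iarr s' ''adj'' (int a * int l + int b) =
      (if a = i \<and> b < k \<and> rides i b then 1 else iarr s ''adj'' (int a * int l + int b)))"],
      goal_cases)
  case (6 k t s')
  have "inputs s'" using s 6(5) by (simp add: inputs_def frame_def)
  moreover have i': "ivar s' ''i'' = int i" using 6(5) i by (simp add: frame_def)
  moreover have "\<forall>v::nat. iarr s' ''mark'' (int v) = int i + 1 \<longleftrightarrow> v \<in> set (route I i)"
    using mark 6(5) by (simp add: frame_def)
  ultimately have test: "tval rides_test s' \<longleftrightarrow> rides i k"
    using rides_test_iff[of s' i k] 6 i by simp
  have row': "iarr s' ''row'' (int i) = int i * int l" using row 6(5) by (simp add: frame_def)
  have "{j. (j < k \<or> j = k) \<and> rides i j} =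
      (if rides i k then insert k {j. j < k \<and> rides i j} else {j. j < k \<and> rides i j})"
    by auto
  then have card_Suc: "card {j. (j < k \<or> j = k) \<and> rides i j} =
      card {j. j < k \<and> rides i j} + (if rides i k then 1 else 0)"
    by simp
  show ?case
    using 6 i i' row' by (auto simp: test card_Suc row_index_eq less_Suc_eq)
next
  case (7 t s')
  have "{j. j < l \<and> rides i j} = {j. rides i j}" by (auto simp: rides_iff)
  then show ?case using 7 by (simp add: deg_def rides_iff cong: conj_cong)
qed (use s i deg0 in \<open>auto simp: inputs_def frame_def\<close>)

text \<open>The route lengths stay inside the sum because their total is bounded by the instance
  size, not in terms of \<open>l\<close>.\<close>

lemma setup_runs:
  assumes s: "inputs s" "path_inputs s"
    and zero: "\<And>a x. a \<in> {''mark'', ''row'', ''deg'', ''adj'', ''load''} \<Longrightarrow> iarr s a x = 0"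
  shows "runs setup_prog s (\<lambda>n s'. n \<le> 2 + (\<Sum>i<l. 12 + 3 * length (route I i) + 5 * l) \<and>
    inputs s' \<and> tables s' \<and> represents (\<lambda>j. j) s')"
  unfolding setup_prog_def
proof (rule runs_For[where lo = 0 and hi = l and
      Inv = "\<lambda>k t s'. t \<le> 1 + (\<Sum>i<k. 12 + 3 * length (route I i) + 5 * l) \<and>
        (\<forall>v::nat. iarr s' ''mark'' (int v) \<le> int k) \<and>
        (\<forall>a<k. iarr s' ''driver'' (int a) = int a) \<and>
        (\<forall>a\<le>k. iarr s' ''row'' (int a) = int a * int l) \<and>
        (\<forall>a<l. iarr s' ''deg'' (int a) = (if a < k then int (deg a) else 0)) \<and>
        (\<forall>a<l. \<forall>b<l. iarr s' ''adj'' (int a * int l + int b) =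
           (if a < k \<and> rides a b then 1 else 0))"], goal_cases)
  case (6 k t s')
  note inv = 6(3) and f = 6(5)[unfolded mark_route_def fill_row_def, simplified]
  have s': "inputs s'" "path_inputs s'"
    using s f by (simp_all add: inputs_def path_inputs_def frame_def)
  show ?case
    unfolding runs_Seq
  proof (rule runs_frame[OF mark_route_runs[OF s'(2) 6(2,4)]], goal_cases)
    case (1 n1 s1)
    note f1 = 1(2)[unfolded mark_route_def, simplified]
    \<comment> \<open>Marks left by earlier trips are at most \<open>k\<close>, so
      \<open>k + 1\<close> identifies the current route.\<close>
    have mark1: "\<forall>v::nat. iarr s1 ''mark'' (int v) = int k + 1 \<longleftrightarrow> v \<in> set (route I k)"
    proof
      fix v :: nat
      have "iarr s' ''mark'' (int v) \<le> int k" using inv by blast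
      then show "iarr s1 ''mark'' (int v) = int k + 1 \<longleftrightarrow> v \<in> set (route I k)"
        using 1(1) by simp
    qed
    have mark1': "\<forall>v::nat. iarr s1 ''mark'' (int v) \<le> int k + 1"
    proof
      fix v :: nat
      have "iarr s' ''mark'' (int v) \<le> int k" using inv by blast
      then show "iarr s1 ''mark'' (int v) \<le> int k + 1"
        using 1(1) by simp
    qed
    have s1: "inputs s1" "ivar s1 ''i'' = int k"
      "iarr s1 ''row'' (int k) = int k * int l" "iarr s1 ''deg'' (int k) = 0"
      using s' inv 6(2,4) f1 by (simp_all add: inputs_def frame_def)
    show ?case
    proof (rule runs_frame[OF fill_row_runs[OF s1(1) 6(2) s1(2-4) mark1]], goal_cases)
      case (1 n2 s2)
      note f2 = 1(2)[unfolded fill_row_def, simplified]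
      have s2: "ivar s2 ''i'' = int k" "ivar s2 ''ntrips'' = int l"
        "iarr s2 ''row'' = iarr s' ''row''" "iarr s2 ''driver'' = iarr s' ''driver''"
        "iarr s2 ''mark'' = iarr s1 ''mark''"
        "iarr s1 ''deg'' = iarr s' ''deg''" "iarr s1 ''adj'' = iarr s' ''adj''"
        using s1 f1 f2 by (simp_all add: inputs_def frame_def)
      show ?case
        using 1(1) inv mark1' s2 \<open>n1 \<le> _ \<and> _\<close>
        by (auto simp: less_Suc_eq le_Suc_eq algebra_simps)
    qed
  qed
next
  case (7 t s')
  have z: "iarr s' ''load'' = iarr s ''load''"
    using 7(2) by (simp add: mark_route_def fill_row_def frame_def)
  have "inputs s'"
    using 7(2) s by (simp add: mark_route_def fill_row_def frame_def inputs_def)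
  then show ?case
    using 7 zero z by (auto simp: tables_def represents_def passengers_def)
qed (use s zero in \<open>auto simp: inputs_def frame_def mark_route_def fill_row_def\<close>)

section \<open>Greedy filling of one vehicle\<close>

lemma candidate_test_iff:
  assumes "inputs s" "tables s" "represents D s"
    and i: "i < l" "ivar s ''i'' = int i" and j: "j < l" "ivar s ''j'' = int j"
  shows "tval (candidate_test b) s \<longleftrightarrow> j \<in> candidates b D i"
proof -
  have eq: "\<not> x < y \<and> \<not> y < x \<longleftrightarrow> x = y" for x y :: int by auto
  have vals: "iarr s ''row'' (int i) = int i * int l" "iarr s ''deg'' (int i) = int (deg i)"
    "iarr s ''deg'' (int j) = int (deg j)"
    "iarr s ''adj'' (int i * int l + int j) = (if rides i j then 1 else 0)"
    "iarr s ''driver'' (int j) = int (D j)" "iarr s ''load'' (int j) = int (card (passengers D j))"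
    using assms by (simp_all add: tables_def represents_def)
  have "int (card (passengers D j)) < 1 \<longleftrightarrow> passengers D j = {}" by auto
  then show ?thesis
    unfolding candidate_test_def tval.simps ival.simps i j vals eq candidates_def free_def by auto
qed

text \<open>The first state supplies the counts and the second the outcome. Thus it serves as
  invariant of the scan and, with both states equal, of the loop that takes passengers.\<close>

definition best_pick :: "nat set \<Rightarrow> state \<Rightarrow> state \<Rightarrow> bool" where
  "best_pick A s s' \<longleftrightarrow>
     (\<forall>j\<in>A. iarr s ''cnt'' (int (src j)) \<le> ivar s' ''best'') \<and>
     (ivar s' ''best'' = 0 \<or> (\<exists>p\<in>A. ivar s' ''pick'' = int p \<and>
        ivar s' ''best'' = iarr s ''cnt'' (int (src p)) \<and> 0 < ivar s' ''best''))"

definition available :: "nat \<Rightarrow> (nat \<Rightarrow> nat) \<Rightarrow> nat \<Rightarrow> state \<Rightarrow> nat set" where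
  "available b D i s = {j \<in> candidates b D i.
     int l < iarr s ''cnt'' (int (src j)) \<or> ivar s ''used'' < int (stp i)}"

lemma scan_runs:
  assumes s: "inputs s" "tables s" "represents D s" and i: "i < l" "ivar s ''i'' = int i"
  shows "runs (scan b) s (\<lambda>n s'. n \<le> 4 + 5 * l \<and> best_pick (available b D i s) s s')"
  unfolding scan_def runs_Seq runs_IAssign
proof (rule runs_For[where lo = 0 and hi = l and
      Inv = "\<lambda>k t s'. t \<le> 1 + 5 * k \<and> best_pick {j \<in> available b D i s. j < k} s s'"],
    goal_cases)
  case (6 k t s')
  note f = 6(5)[unfolded frame_def, simplified]
  have s': "inputs s'" "tables s'" "represents D s'" "ivar s' ''i'' = int i"
    using s i f by (simp_all add: inputs_def tables_def represents_def)
  have test: "tval (candidate_test b) s' \<longleftrightarrow> k \<in> candidates b D i"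
    using candidate_test_iff[OF s'(1-3) i(1) s'(4) 6(2,4)] .
  have vals: "iarr s' ''source'' (int k) = int (src k)" "ivar s' ''ntrips'' = int l"
    "iarr s' ''stops'' (int i) = int (stp i)"
    using s'(1) 6(2) i by (simp_all add: inputs_def)
  have same: "iarr s' ''cnt'' = iarr s ''cnt''" "ivar s' ''used'' = ivar s ''used''"
    using f by simp_all
  have avail: "k \<in> available b D i s \<longleftrightarrow> k \<in> candidates b D i \<and>
      (int l < iarr s ''cnt'' (int (src k)) \<or> ivar s ''used'' < int (stp i))"
    by (simp add: available_def)
  have split: "{j \<in> available b D i s. j < Suc k} =
      (if k \<in> available b D i s then insert k {j \<in> available b D i s. j < k}
       else {j \<in> available b D i s. j < k})"
    by (auto simp: less_Suc_eq)
  let ?c = "iarr s ''cnt'' (int (src k))"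
  let ?A = "{j \<in> available b D i s. j < k}"
  have old: "best_pick ?A s s'" "t \<le> 1 + 5 * k" using 6(3) by simp_all
  have skip: "best_pick {j \<in> available b D i s. j < Suc k} s s''"
    if "k \<in> available b D i s \<Longrightarrow> ?c \<le> ivar s' ''best''"
      "ivar s'' ''best'' = ivar s' ''best''" "ivar s'' ''pick'' = ivar s' ''pick''" for s''
    using old(1) that by (cases "k \<in> available b D i s") (simp_all add: split best_pick_def, blast)
  have improve: "best_pick {j \<in> available b D i s. j < Suc k} s s''"
    if "k \<in> available b D i s" "ivar s' ''best'' < ?c"
      "ivar s'' ''best'' = ?c" "ivar s'' ''pick'' = int k" for s''
  proof -
    \<comment> \<open>Hence a count that beats \<open>best\<close> is positive, as the second clause
      of \<open>best_pick\<close> demands.\<close>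
    have "0 \<le> ivar s' ''best''" using old(1) by (auto simp: best_pick_def)
    then show ?thesis using old(1) that by (auto simp: split best_pick_def)
  qed
  show ?case
  proof (cases "k \<in> available b D i s \<and> ivar s' ''best'' < ?c")
    case True
    then show ?thesis
      using avail test vals same old(2) 6(4) s'(4) by (simp add: improve)
  next
    case False
    then show ?thesis
      using avail test vals same old(2) 6(4) s'(4) by (auto intro!: skip)
  qed
next
  case (7 t s')
  have "{j \<in> available b D i s. j < l} = available b D i s"
    using candidates_subset by (auto simp: available_def)
  then show ?case using 7 by simp
qed (use s in \<open>auto simp: inputs_def frame_def best_pick_def\<close>)

lemma clear_counts_runs:
  assumes s: "inputs s"
  shows "runs clear_counts s (\<lambda>n s'. n \<le> 2 + 3 * l \<and> (\<forall>j<l. iarr s' ''cnt'' (int (src j)) = 0))"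
  unfolding clear_counts_def
proof (rule runs_For[where lo = 0 and hi = l and
      Inv = "\<lambda>k t s'. t \<le> 1 + 3 * k \<and> (\<forall>j<k. iarr s' ''cnt'' (int (src j)) = 0)"], goal_cases)
  case (6 k t s')
  have "iarr s' ''source'' (int k) = int (src k)"
    using s 6(2,5) by (simp add: inputs_def frame_def)
  then show ?case using 6 by (auto simp: less_Suc_eq)
qed (use s in \<open>auto simp: inputs_def frame_def\<close>)

lemma count_candidates_runs:
  assumes s: "inputs s" "tables s" "represents D s" and i: "i < l" "ivar s ''i'' = int i"
    and zero: "\<forall>j<l. iarr s ''cnt'' (int (src j)) = 0"
  shows "runs (count_candidates b) s (\<lambda>n s'. n \<le> 2 + 4 * l \<and> (\<forall>j<l.
    iarr s' ''cnt'' (int (src j)) = int (card {k \<in> candidates b D i. src k = src j})))"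
  unfolding count_candidates_def
proof (rule runs_For[where lo = 0 and hi = l and
      Inv = "\<lambda>k t s'. t \<le> 1 + 4 * k \<and> (\<forall>j<l. iarr s' ''cnt'' (int (src j)) =
        int (card {m \<in> candidates b D i. src m = src j \<and> m < k}))"], goal_cases)
  case (6 k t s')
  note f = 6(5)[unfolded frame_def, simplified]
  have s': "inputs s'" "tables s'" "represents D s'" "ivar s' ''i'' = int i"
    using s i f by (simp_all add: inputs_def tables_def represents_def)
  have test: "tval (candidate_test b) s' \<longleftrightarrow> k \<in> candidates b D i"
    using candidate_test_iff[OF s'(1-3) i(1) s'(4) 6(2,4)] .
  have vals: "iarr s' ''source'' (int k) = int (src k)"
    using s'(1) 6(2) by (simp_all add: inputs_def)
  have "{m \<in> candidates b D i. src m = v \<and> m < Suc k} =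
      (if k \<in> candidates b D i \<and> src k = v
       then insert k {m \<in> candidates b D i. src m = v \<and> m < k}
       else {m \<in> candidates b D i. src m = v \<and> m < k})" for v
    by (auto simp: less_Suc_eq)
  then have card_Suc: "card {m \<in> candidates b D i. src m = v \<and> m < Suc k} =
      card {m \<in> candidates b D i. src m = v \<and> m < k} +
      (if k \<in> candidates b D i \<and> src k = v then 1 else 0)" for v
    by simp
  show ?case
    using 6 test vals unfolding card_Suc by auto
next
  case (7 t s')
  have "{m \<in> candidates b D i. src m = v \<and> m < l} = {m \<in> candidates b D i. src m = v}" for v
    using candidates_subset by auto
  then show ?case using 7 by simp
qed (use s zero in \<open>auto simp: inputs_def frame_def\<close>)

text \<open>Supplies the hypotheses of \<open>greedy_sated\<close> for the sources of
  \<open>T\<close> other than that of \<open>i\<close>. Groups are counted in the original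
  \<open>C\<close>; at an unopened source nobody has boarded, so these counts are still
  current.\<close>

definition greedy_state :: "nat set \<Rightarrow> nat \<Rightarrow> nat set \<Rightarrow> state \<Rightarrow> bool" where
  "greedy_state C i T s \<longleftrightarrow>
     T \<subseteq> C \<and> feas i T \<and>
     ivar s ''used'' = int (card (src ` T - {src i})) \<and>
     (\<forall>j<l. iarr s ''cnt'' (int (src j)) =
        (if src j \<in> insert (src i) (src ` T) then int l + 1
         else int (card {k \<in> C. src k = src j}))) \<and>
     (\<forall>v\<in>src ` T - {src i}. \<forall>w. w \<notin> insert (src i) (src ` T) \<longrightarrow>
        card {k \<in> C. src k = w} \<le> card {k \<in> C. src k = v})"

lemma candidates_board:
  assumes "free D i" "T \<subseteq> candidates b D i"
  shows "candidates b (board D i T) i = candidates b D i - T"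
  using free_board[OF assms] free_board_other[OF assms] by (auto simp: candidates_def)

lemma source_group_le:
  assumes "C \<subseteq> {..<l}"
  shows "card {k \<in> C. src k = v} \<le> l"
  using card_mono[of "{..<l}" "{k \<in> C. src k = v}"] assms by auto

lemma feas_insert:
  assumes T: "feas i T" "card T < cap i" and p: "rides i p" "p \<notin> T"
    and stop: "src p \<in> insert (src i) (src ` T) \<or> card (src ` T - {src i}) < stp i"
  shows "feas i (insert p T)"
proof -
  have fin: "finite T" using T feas_finite by blast
  have "src ` insert p T - {src i} = (if src p \<in> insert (src i) (src ` T)
      then src ` T - {src i} else insert (src p) (src ` T - {src i}))"
    by auto
  then have "card (src ` insert p T - {src i}) \<le> stp i"
    using T stop fin by (auto simp: feasible_load_def)
  then show ?thesis
    using T p fin by (auto simp: feasible_load_def rides_iff)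
qed

text \<open>If the source of \<open>p\<close> is open already, sources and counts do not change.
  Otherwise a stop is left, and the choice of \<open>p\<close> makes its group at least as large as
  every group still unopened.\<close>

lemma take_pick_runs:
  assumes s: "inputs s" "represents (board D i T) s" and i: "i < l" "ivar s ''i'' = int i"
    and D: "free D i" and C: "C = candidates b D i"
    and g: "greedy_state C i T s" and room: "card T < cap i"
    and p: "p \<in> C - T" "ivar s ''pick'' = int p"
      "int l < iarr s ''cnt'' (int (src p)) \<or> ivar s ''used'' < int (stp i)"
    and max: "\<And>j. j \<in> C - T \<Longrightarrow>
      int l < iarr s ''cnt'' (int (src j)) \<or> ivar s ''used'' < int (stp i) \<Longrightarrow>
      iarr s ''cnt'' (int (src j)) \<le> iarr s ''cnt'' (int (src p))"
  shows "runs take_pick s (\<lambda>n s'. n \<le> 5 \<and> greedy_state C i (insert p T) s' \<and>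
    represents (board D i (insert p T)) s')"
proof -
  let ?O = "insert (src i) (src ` T)"
  let ?g = "\<lambda>v. card {k \<in> C. src k = v}"
  have Cl: "C \<subseteq> {..<l}" using C candidates_subset by simp
  have fin: "finite C" "finite T"
    using g Cl C by (auto simp: greedy_state_def intro: finite_subset)
  have pl: "p < l" using p Cl by auto
  have gl: "int (?g v) \<le> int l" for v using source_group_le[OF Cl] by simp
  have cnt: "iarr s ''cnt'' (int (src j)) = (if src j \<in> ?O then int l + 1 else int (?g (src j)))"
    if "j < l" for j using g that by (simp add: greedy_state_def)
  have used: "ivar s ''used'' = int (card (src ` T - {src i}))"
    using g by (simp add: greedy_state_def)
  \<comment> \<open>A true group has at most \<open>l\<close> members, so the value
    \<open>l + 1\<close> is unambiguous.\<close>
  have open_iff: "int l < iarr s ''cnt'' (int (src p)) \<longleftrightarrow> src p \<in> ?O"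
    using cnt[OF pl] gl[of "src p"] by auto
  have TC: "T \<subseteq> C" "insert p T \<subseteq> C" using g p by (auto simp: greedy_state_def)
  have "rides i p" using p C by (simp add: candidates_def)
  then have feas: "feas i (insert p T)"
    using g room p open_iff used by (intro feas_insert) (auto simp: greedy_state_def)
  have "p \<noteq> i" using p C by (auto simp: candidates_def)
  have pass: "passengers (board D i (insert p T)) k =
      (if k = i then insert p T else passengers (board D i T) k)" for k
    using passengers_board[OF D] TC C by simp
  have rep: "represents (board D i (insert p T)) s'"
    if "iarr s' ''driver'' = (iarr s ''driver'')(int p := int i)"
      "iarr s' ''load'' = (iarr s ''load'')(int i := iarr s ''load'' (int i) + 1)" for s'
  proof -
    have "iarr s ''load'' (int i) = int (card T)"
      using s(2) i passengers_board[OF D] TC C by (simp add: represents_def)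
    then show ?thesis
      using s(2) that p fin pass \<open>p \<noteq> i\<close> by (auto simp: represents_def board_def)
  qed
  have vals: "iarr s ''source'' (int p) = int (src p)" "ivar s ''ntrips'' = int l"
    using s pl by (simp_all add: inputs_def)
  show ?thesis
  proof (cases "src p \<in> ?O")
    case True
    then have O: "insert (src i) (src ` insert p T) = ?O"
        "src ` insert p T - {src i} = src ` T - {src i}" by auto
    have "greedy_state C i (insert p T) s'"
      if "ivar s' = ivar s" "iarr s' ''cnt'' = iarr s ''cnt''" for s'
      using g feas TC unfolding greedy_state_def O that by simp
    then show ?thesis
      using True open_iff vals p i rep by (simp add: take_pick_def)
  next
    case False
    have O: "insert (src i) (src ` insert p T) = insert (src p) ?O"
      "src ` insert p T - {src i} = insert (src p) (src ` T - {src i})"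
      using False by auto
    have few: "card (src ` T - {src i}) < stp i"
      using p(3) False open_iff used by simp
    \<comment> \<open>A candidate at \<open>w\<close> could be taken too, since a stop is left, so
      it competed with \<open>p\<close>.\<close>
    have dom_p: "?g w \<le> ?g (src p)" if w: "w \<notin> insert (src p) ?O" for w
    proof (cases "\<exists>j\<in>C. src j = w")
      case True
      then obtain j where j: "j \<in> C" "src j = w" by blast
      then have "j \<in> C - T" "j < l" using w Cl by auto
      then have "iarr s ''cnt'' (int (src j)) \<le> iarr s ''cnt'' (int (src p))"
        using few used by (intro max) auto
      then show ?thesis using cnt[OF pl] cnt[OF \<open>j < l\<close>] False w j by auto
    next
      case no: False
      then have "{k \<in> C. src k = w} = {}" by auto
      then show ?thesis by (metis card.empty le0)
    qed
    have dom: "\<forall>v\<in>insert (src p) (src ` T - {src i}). \<forall>w. w \<notin> insert (src p) ?O \<longrightarrow>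
        ?g w \<le> ?g v"
      using dom_p g by (auto simp: greedy_state_def)
    have used': "card (insert (src p) (src ` T - {src i})) = Suc (card (src ` T - {src i}))"
      using False fin by (simp add: card_insert_if)
    have "greedy_state C i (insert p T) s'"
      if "ivar s' ''used'' = ivar s ''used'' + 1"
        "iarr s' ''cnt'' = (iarr s ''cnt'')(int (src p) := int l + 1)" for s'
    proof -
      have "iarr s' ''cnt'' (int (src j)) = (if src j \<in> insert (src p) ?O then int l + 1
          else int (?g (src j)))" if "j < l" for j
        using cnt[OF \<open>j < l\<close>] \<open>iarr s' ''cnt'' = _\<close> by (cases "src j = src p") auto
      then show ?thesis
        unfolding greedy_state_def O used' using dom feas TC that used by simp
    qed
    then show ?thesis
      using False open_iff vals p i rep
      by (simp add: take_pick_def)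
  qed
qed

definition picked_state :: "nat \<Rightarrow> (nat \<Rightarrow> nat) \<Rightarrow> nat \<Rightarrow> nat set \<Rightarrow> state \<Rightarrow> bool" where
  "picked_state b D i T s \<longleftrightarrow> represents (board D i T) s \<and>
     greedy_state (candidates b D i) i T s \<and> best_pick (available b (board D i T) i s) s s"

lemma scan_picked:
  assumes s: "inputs s" "tables s" "represents (board D i T) s"
    and i: "i < l" "ivar s ''i'' = int i"
    and g: "greedy_state (candidates b D i) i T s"
  shows "runs (scan b) s (\<lambda>n s'. n \<le> 4 + 5 * l \<and> picked_state b D i T s')"
proof (rule runs_frame[OF scan_runs[OF s i, of b]], goal_cases)
  case (1 n s')
  note f = 1(2)[unfolded scan_def frame_def, simplified]
  have "available b (board D i T) i s' = available b (board D i T) i s"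
    using f by (simp add: available_def)
  then show ?case
    using 1(1) s(3) g f
    by (simp add: picked_state_def represents_def greedy_state_def best_pick_def)
qed

text \<open>Each round fills a seat, so the empty seats serve as measure. A round costs at most 10
  steps plus 5 per trip, mostly for the scan.\<close>

lemma take_loop_runs:
  assumes s: "inputs s" "tables s" and i: "i < l" "ivar s ''i'' = int i"
    and D: "free D i" and start: "picked_state b D i {} s"
  shows "runs (take_loop b) s (\<lambda>n s'. \<exists>T. sated i (candidates b D i) T \<and>
    represents (board D i T) s' \<and> n \<le> 1 + 10 * (l + 1) * card T)"
  unfolding take_loop_def
proof (rule runs_While[where
      Inv = "\<lambda>t s'. \<exists>T. picked_state b D i T s' \<and> t \<le> 10 * (l + 1) * card T" and
      m = "\<lambda>s'. nat (int (cap i) - iarr s' ''load'' (int i))"], goal_cases)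
  case 1
  then show ?case using start by auto
next
  case (2 t s')
  then obtain T where T: "picked_state b D i T s'" "t \<le> 10 * (l + 1) * card T" by blast
  note f = 2(2)[unfolded take_pick_def scan_def frame_def, simplified]
  let ?C = "candidates b D i"
  have s': "inputs s'" "tables s'" "ivar s' ''i'' = int i"
    using s i f by (simp_all add: inputs_def tables_def)
  have rep: "represents (board D i T) s'" and g: "greedy_state ?C i T s'"
    and best: "best_pick (available b (board D i T) i s') s' s'"
    using T by (simp_all add: picked_state_def)
  have TC: "T \<subseteq> ?C" using g by (simp add: greedy_state_def)
  have fin: "finite T" using TC finite_subset by (metis candidates_finite)
  have avail: "available b (board D i T) i s' = {j \<in> ?C - T.
      int l < iarr s' ''cnt'' (int (src j)) \<or> ivar s' ''used'' < int (stp i)}"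
    by (simp add: available_def candidates_board[OF D TC])
  have load: "iarr s' ''load'' (int i) = int (card T)"
    using rep i passengers_board[OF D TC] by (simp add: represents_def)
  have "iarr s' ''capacity'' (int i) = int (cap i)" using s' i by (simp add: inputs_def)
  then have room: "card T < cap i" and pos: "0 < ivar s' ''best''"
    using 2(3) load s' by simp_all
  obtain p where p: "p \<in> available b (board D i T) i s'" "ivar s' ''pick'' = int p"
      "ivar s' ''best'' = iarr s' ''cnt'' (int (src p))"
    using best pos by (auto simp: best_pick_def)
  have max: "iarr s' ''cnt'' (int (src j)) \<le> iarr s' ''cnt'' (int (src p))"
    if "j \<in> ?C - T" "int l < iarr s' ''cnt'' (int (src j)) \<or> ivar s' ''used'' < int (stp i)" for j
    using best p(3) that avail by (simp add: best_pick_def)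
  have p': "p \<in> ?C - T" "int l < iarr s' ''cnt'' (int (src p)) \<or> ivar s' ''used'' < int (stp i)"
    using p(1) avail by simp_all
  show ?case
    unfolding runs_Seq
  proof (rule runs_frame[OF take_pick_runs[OF s'(1) rep i(1) s'(3) D refl g room p'(1) p(2) p'(2)
          max]], assumption, assumption, goal_cases)
    case (1 n1 s1)
    note f1 = 1(2)[unfolded take_pick_def frame_def, simplified]
    have s1: "inputs s1" "tables s1" "ivar s1 ''i'' = int i"
      using s' f1 by (simp_all add: inputs_def tables_def)
    have card: "card (insert p T) = Suc (card T)" using p'(1) fin by simp
    have TC1: "insert p T \<subseteq> ?C" using TC p' by simp
    have g1: "greedy_state ?C i (insert p T) s1" "represents (board D i (insert p T)) s1"
      using 1(1) by simp_all
    show ?case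
    proof (rule runs_mono[OF scan_picked[OF s1(1,2) g1(2) i(1) s1(3) g1(1)]], goal_cases)
      case (1 n2 s2)
      then have pick2: "picked_state b D i (insert p T) s2" by simp
      have "iarr s2 ''load'' (int i) = int (card (insert p T))"
        using pick2 i passengers_board[OF D TC1]
        by (simp add: picked_state_def represents_def)
      then show ?case
        using \<open>n1 \<le> 5 \<and> _\<close> 1 T(2) room load pick2 card
        by (intro conjI exI[of _ "insert p T"]) simp_all
    qed
  qed
next
  case (3 t s')
  then obtain T where T: "picked_state b D i T s'" "t \<le> 10 * (l + 1) * card T" by blast
  note f = 3(2)[unfolded take_pick_def scan_def frame_def, simplified]
  let ?C = "candidates b D i"
  have s': "inputs s'" "ivar s' ''i'' = int i"
    using s i f by (simp_all add: inputs_def)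
  have rep: "represents (board D i T) s'" and g: "greedy_state ?C i T s'"
    and best: "best_pick (available b (board D i T) i s') s' s'"
    using T by (simp_all add: picked_state_def)
  have TC: "T \<subseteq> ?C" and feas: "feas i T" using g by (simp_all add: greedy_state_def)
  have fin: "finite T" using feas by (rule feas_finite)
  have load: "iarr s' ''load'' (int i) = int (card T)"
    using rep i passengers_board[OF D TC] by (simp add: represents_def)
  have "iarr s' ''capacity'' (int i) = int (cap i)" using s' i by (simp add: inputs_def)
  then have ended: "ivar s' ''best'' \<le> 0 \<or> cap i \<le> card T"
    using 3(3) load s' by auto
  have "sated i ?C T"
  proof (rule greedy_sated[OF candidates_subset TC feas, where S = "src ` T - {src i}"])
    show "card T = cap i \<or> (\<forall>j\<in>?C - T. src j \<notin> insert (src i) (src ` T - {src i}) \<and>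
        card (src ` T - {src i}) = stp i)"
    proof (cases "cap i \<le> card T")
      case True
      then show ?thesis using feas by (simp add: feasible_load_def)
    next
      case False
      have "src j \<notin> insert (src i) (src ` T - {src i}) \<and> card (src ` T - {src i}) = stp i"
        if j: "j \<in> ?C - T" for j
      proof -
        have jl: "j < l" using j candidates_subset by auto
        \<comment> \<open>The group of \<open>j\<close> contains \<open>j\<close>, so its count is
          positive. If \<open>j\<close> were available, the last scan would have left a positive
          \<open>best\<close>, but the loop has ended with seats to spare.\<close>
        have "0 < card {k \<in> ?C. src k = src j}"
          using j by (auto simp: card_gt_0_iff)
        then have cnt: "0 < iarr s' ''cnt'' (int (src j))"
            "src j \<in> insert (src i) (src ` T) \<Longrightarrow> int l < iarr s' ''cnt'' (int (src j))"
          using g jl by (auto simp: greedy_state_def)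
        have "j \<notin> available b (board D i T) i s'"
          using best cnt(1) ended False by (auto simp: best_pick_def)
        then have "\<not> int l < iarr s' ''cnt'' (int (src j))" "\<not> ivar s' ''used'' < int (stp i)"
          using j by (auto simp: available_def candidates_board[OF D TC])
        moreover have "card (src ` T - {src i}) \<le> stp i"
          using feas by (simp add: feasible_load_def)
        ultimately show ?thesis
          using cnt(2) g by (auto simp: greedy_state_def)
      qed
      then show ?thesis by blast
    qed
  qed (use g fin in \<open>auto simp: greedy_state_def\<close>)
  then show ?case using T rep by auto
qed

text \<open>The summand 1 next to \<open>card T\<close> pays for clearing, counting and the first
  scan, which happen even if nobody boards.\<close>

lemma fill_vehicle_runs:
  assumes s: "inputs s" "tables s" "represents D s"
    and i: "i < l" "ivar s ''i'' = int i" and D: "free D i"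
  shows "runs (fill_vehicle b) s (\<lambda>n s'. \<exists>T. sated i (candidates b D i) T \<and>
    represents (board D i T) s' \<and> n \<le> 20 * (l + 1) * (card T + 1))"
  unfolding fill_vehicle_def runs_Seq
proof (rule runs_frame[OF clear_counts_runs[OF s(1)]], goal_cases)
  case (1 n1 s1)
  note f1 = 1(2)[unfolded clear_counts_def frame_def, simplified]
  have s1: "inputs s1" "tables s1" "represents D s1" "ivar s1 ''i'' = int i"
    using s i f1 by (simp_all add: inputs_def tables_def represents_def)
  have zero: "\<forall>j<l. iarr s1 ''cnt'' (int (src j)) = 0" and n1: "n1 \<le> 2 + 3 * l"
    using 1(1) by auto
  show ?case
  proof (rule runs_frame[OF count_candidates_runs[OF s1(1-3) i(1) s1(4) zero]], goal_cases)
    case (1 n2 s2)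
    note f2 = 1(2)[unfolded count_candidates_def frame_def, simplified]
    have s2: "inputs s2" "tables s2" "represents D s2" "ivar s2 ''i'' = int i"
      using s1 i f2 by (simp_all add: inputs_def tables_def represents_def)
    let ?s = "s2\<lparr>iarr := (iarr s2)(''cnt'' := (iarr s2 ''cnt'')(int (src i) := int l + 1)),
        ivar := (ivar s2)(''used'' := 0)\<rparr>"
    have board_empty: "board D i {} = D" by (auto simp: board_def)
    have s3: "inputs ?s" "tables ?s" "represents (board D i {}) ?s" "ivar ?s ''i'' = int i"
      using s2 by (simp_all add: inputs_def tables_def represents_def board_empty)
    have "feas i {}" by (simp add: feasible_load_def)
    then have g3: "greedy_state (candidates b D i) i {} ?s"
      using 1(1) by (auto simp: greedy_state_def)
    have vals: "iarr s2 ''source'' (int i) = int (src i)" "ivar s2 ''ntrips'' = int l"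
      using s2 i by (simp_all add: inputs_def)
    have "runs (scan b) ?s (\<lambda>n3 s4. runs (take_loop b) s4 (\<lambda>n4 s'.
        \<exists>T. sated i (candidates b D i) T \<and> represents (board D i T) s' \<and>
          n1 + (n2 + (1 + (1 + (n3 + n4)))) \<le> 20 * (l + 1) * (card T + 1)))"
    proof (rule runs_frame[OF scan_picked[OF s3(1-3) i(1) s3(4) g3]], goal_cases)
      case (1 n3 s4)
      note f4 = 1(2)[unfolded scan_def frame_def, simplified]
      have s4: "inputs s4" "tables s4" "ivar s4 ''i'' = int i"
        using s3 f4 by (simp_all add: inputs_def tables_def)
      show ?case
      proof (rule runs_mono[OF take_loop_runs[OF s4(1,2) i(1) s4(3) D conjunct2[OF 1(1)]]],
          goal_cases)
        case (1 n4 s')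
        then obtain T where T: "sated i (candidates b D i) T" "represents (board D i T) s'"
          "n4 \<le> 1 + 10 * (l + 1) * card T" by blast
        have "n4 \<le> 1 + 20 * (l + 1) * card T" by (rule order_trans[OF T(3)]) simp
        moreover have "n2 \<le> 2 + 4 * l" "n3 \<le> 4 + 5 * l"
          using \<open>n2 \<le> _ \<and> _\<close> \<open>n3 \<le> _ \<and> _\<close> by simp_all
        ultimately have "n1 + (n2 + (1 + (1 + (n3 + n4)))) \<le> 20 * (l + 1) + 20 * (l + 1) * card T"
          using n1 by (simp add: algebra_simps)
        then show ?case using T(1,2) by (auto simp: algebra_simps)
      qed
    qed
    then show ?case using vals s2(4) by simp
  qed
qed

section \<open>The sweeps by increasing degree\<close>

text \<open>The trips that \<open>sweep\<close> has examined when the counters are at \<open>d\<close> and \<open>k\<close>.\<close>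

definition examined :: "nat \<Rightarrow> nat \<Rightarrow> nat set" where
  "examined d k = {z. z < l \<and> (deg z < d \<or> deg z = d \<and> z < k)}"

text \<open>\<open>Z\<close> holds the examined trips. In the first sweep unexamined trips are free,
  so every trip is served when its turn comes and ends up settled. The second sweep promises this
  only for trips that are still free. \<open>D\<^sub>0\<close> is the start, through which results
  of the first sweep survive.\<close>

definition sweep_inv :: "nat \<Rightarrow> (nat \<Rightarrow> nat) \<Rightarrow> nat set \<Rightarrow> (nat \<Rightarrow> nat) \<Rightarrow> bool" where
  "sweep_inv b D\<^sub>0 Z D \<longleftrightarrow> valid D \<and> extends D\<^sub>0 D \<and>
     (\<forall>z\<in>Z. free D z \<or> b = 0 \<longrightarrow> settled b D z) \<and>
     (b = 0 \<longrightarrow> (\<forall>z<l. z \<notin> Z \<longrightarrow> free D z))"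

text \<open>
  Filling a vehicle takes linear time per examined trip and per new passenger, so that the time of
  a sweep telescopes in this potential.
\<close>

definition potential :: "nat set \<Rightarrow> (nat \<Rightarrow> nat) \<Rightarrow> nat" where
  "potential Z D = 20 * (l + 1) * (card Z + card {j. j < l \<and> D j \<noteq> j})"

lemma examined_Suc:
  "k < l \<Longrightarrow> examined d (Suc k) = (if deg k = d then insert k (examined d k) else examined d k)"
  by (auto simp: examined_def less_Suc_eq)

lemma examined_finite [simp]: "finite (examined d k)"
  by (simp add: examined_def)

lemma examined_next: "examined d l = examined (Suc d) 0"
  by (auto simp: examined_def less_Suc_eq)

lemma examined_all: "examined (Suc l) 0 = {..<l}"
  using deg_le by (auto simp: examined_def less_Suc_eq_le)

lemma potential_board:
  assumes "free D i" "T \<subseteq> candidates b D i" "finite Z" "i \<notin> Z"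
  shows "potential (insert i Z) (board D i T) = potential Z D + 20 * (l + 1) * (card T + 1)"
proof -
  have T: "j < l \<and> j \<noteq> i \<and> D j = j" if "j \<in> T" for j
    using assms that by (auto simp: candidates_def free_def rides_iff)
  then have "{j. j < l \<and> board D i T j \<noteq> j} = {j. j < l \<and> D j \<noteq> j} \<union> T"
    using assms(1) by (auto simp: board_def free_def)
  moreover have "{j. j < l \<and> D j \<noteq> j} \<inter> T = {}" using T by auto
  moreover have "finite T" using assms(2) by (metis candidates_finite finite_subset)
  ultimately have "card {j. j < l \<and> board D i T j \<noteq> j} = card {j. j < l \<and> D j \<noteq> j} + card T"
    by (simp add: card_Un_disjoint)
  then show ?thesis using assms(3,4) by (simp add: potential_def algebra_simps)
qed

lemma potential_insert: "finite Z \<Longrightarrow> potential Z D \<le> potential (insert i Z) D"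
  unfolding potential_def by (intro mult_le_mono2 add_le_mono1 card_mono) auto

lemma sweep_inv_board:
  assumes inv: "sweep_inv b D\<^sub>0 (examined (deg i) i) D" and i: "i < l" and D: "free D i"
    and T: "sated i (candidates b D i) T"
  shows "sweep_inv b D\<^sub>0 (insert i (examined (deg i) i)) (board D i T)"
proof -
  have TC: "T \<subseteq> candidates b D i" "feas i T" using T by (simp_all add: sated_def)
  have ext: "extends D (board D i T)" using D TC(1) by (rule extends_board)
  \<comment> \<open>For \<open>b = 0\<close> the trips in \<open>T\<close> have smaller degree than
    \<open>i\<close> and were examined earlier, so an unexamined \<open>z\<close> is not among
    them.\<close>
  have "free (board D i T) z"
    if "b = 0" "z < l" "z \<notin> insert i (examined (deg i) i)" for z
  proof (rule free_board_other[OF D TC(1)])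
    show "free D z" using inv that by (simp add: sweep_inv_def)
    show "z \<notin> T" using TC(1) that by (auto simp: candidates_def examined_def)
  qed (use that in simp)
  moreover have "valid (board D i T)"
    using inv i D TC by (intro valid_board) (simp_all add: sweep_inv_def)
  moreover have "extends D\<^sub>0 (board D i T)"
    using inv ext extends_trans by (auto simp: sweep_inv_def)
  moreover have "settled b (board D i T) z"
    if "z \<in> examined (deg i) i" "free (board D i T) z \<or> b = 0" for z
    using inv that ext free_board(1)[OF D TC(1)] settled_extends[OF ext]
    unfolding sweep_inv_def by blast
  moreover have "settled b (board D i T) i" using D T by (rule settled_board)
  ultimately show ?thesis unfolding sweep_inv_def by blast
qed

text \<open>In the first sweep a trip is free when its turn comes, so skipping occurs only for
  \<open>b\<close> other than 0, where the invariant asks nothing of trips that are not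
  free.\<close>

lemma sweep_inv_skip:
  assumes "sweep_inv b D\<^sub>0 (examined (deg i) i) D" "i < l" "\<not> free D i"
  shows "sweep_inv b D\<^sub>0 (insert i (examined (deg i) i)) D"
proof -
  have "i \<notin> examined (deg i) i" by (simp add: examined_def)
  then have "b \<noteq> 0" using assms by (auto simp: sweep_inv_def)
  then show ?thesis using assms by (simp add: sweep_inv_def)
qed

text \<open>The growth of the potential pays for filling vehicles; four steps per trip remain for
  tests, skips and the counter.\<close>

lemma sweep_degree_runs:
  assumes s: "inputs s" "tables s" "represents D s" and d: "ivar s ''d'' = int d"
    and inv: "sweep_inv b D\<^sub>0 (examined d 0) D"
  shows "runs (sweep_degree b) s (\<lambda>n s'. \<exists>D'. represents D' s' \<and>
    sweep_inv b D\<^sub>0 (examined (Suc d) 0) D' \<and>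
    n + potential (examined d 0) D \<le> 2 + 4 * l + potential (examined (Suc d) 0) D')"
  unfolding sweep_degree_def
proof (rule runs_For[where lo = 0 and hi = l and
      Inv = "\<lambda>k t s'. \<exists>D'. represents D' s' \<and> sweep_inv b D\<^sub>0 (examined d k) D' \<and>
        t + potential (examined d 0) D \<le> 1 + 4 * k + potential (examined d k) D'"], goal_cases)
  case (6 k t s')
  then obtain D' where D': "represents D' s'" "sweep_inv b D\<^sub>0 (examined d k) D'"
    "t + potential (examined d 0) D \<le> 1 + 4 * k + potential (examined d k) D'" by blast
  note f = 6(5)[unfolded prog_defs frame_def, simplified]
  have s': "inputs s'" "tables s'" "ivar s' ''d'' = int d"
    using s d f by (simp_all add: inputs_def tables_def)
  have vals: "iarr s' ''deg'' (int k) = int (deg k)" "iarr s' ''driver'' (int k) = int (D' k)"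
      "iarr s' ''load'' (int k) = int (card (passengers D' k))"
    using s' D'(1) 6(2) by (simp_all add: tables_def represents_def)
  have test: "tval (TAnd (IEq (IArr ''deg'' (IVar ''i'')) (IVar ''d''))
       (TAnd (IEq (IArr ''driver'' (IVar ''i'')) (IVar ''i''))
         (ILess (IArr ''load'' (IVar ''i'')) one))) s' \<longleftrightarrow> deg k = d \<and> free D' k"
    using vals s'(3) 6(4) by (auto simp: free_def)
  have rep: "represents D'' (s''\<lparr>ivar := g\<rparr>) \<longleftrightarrow> represents D'' s''" for D'' s'' g
    by (simp add: represents_def)
  consider "deg k = d" "free D' k" | "deg k = d" "\<not> free D' k" | "deg k \<noteq> d" by blast
  then show ?case
  proof cases
    case 1
    have "runs (fill_vehicle b) s' (\<lambda>n s''. \<exists>D''. represents D'' s'' \<and>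
        sweep_inv b D\<^sub>0 (examined d (Suc k)) D'' \<and>
        t + Suc n + 2 + potential (examined d 0) D
          \<le> 1 + 4 * Suc k + potential (examined d (Suc k)) D'')"
    proof (rule runs_mono[OF fill_vehicle_runs[OF s'(1,2) D'(1) 6(2,4) 1(2)]], goal_cases)
      case (1 n s'')
      then obtain T where T: "sated k (candidates b D' k) T" "represents (board D' k T) s''"
        "n \<le> 20 * (l + 1) * (card T + 1)" by blast
      have "sweep_inv b D\<^sub>0 (examined d (Suc k)) (board D' k T)"
        using sweep_inv_board[of b D\<^sub>0 k D' T] D'(2) \<open>deg k = d\<close> \<open>free D' k\<close> 6(2) T(1)
        by (simp add: examined_Suc)
      moreover have "k \<notin> examined d k" using \<open>deg k = d\<close> by (simp add: examined_def)
      then have "potential (examined d (Suc k)) (board D' k T) =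
          potential (examined d k) D' + 20 * (l + 1) * (card T + 1)"
        using potential_board[OF \<open>free D' k\<close>, of T b "examined d k"] T(1) \<open>deg k = d\<close> 6(2)
        by (simp add: examined_Suc sated_def)
      ultimately show ?case using T D'(3) by (intro exI[of _ "board D' k T"]) simp
    qed
    then show ?thesis unfolding runs_Cond rep using test 1 by simp
  next
    case 2
    have "sweep_inv b D\<^sub>0 (examined d (Suc k)) D'"
      using sweep_inv_skip[of b D\<^sub>0 k D'] D'(2) 2 6(2) by (simp add: examined_Suc)
    moreover have "potential (examined d k) D' \<le> potential (examined d (Suc k)) D'"
      using potential_insert[of "examined d k" D' k] 2 6(2) by (simp add: examined_Suc)
    ultimately show ?thesis
      unfolding runs_Cond rep using test 2 D' by (auto intro!: exI[of _ D'])
  next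
    case 3
    then show ?thesis
      unfolding runs_Cond rep using test D' 6(2) by (auto simp: examined_Suc intro!: exI[of _ D'])
  qed
next
  case (7 t s')
  then show ?case by (auto simp: examined_next)
qed (use s d inv in \<open>auto simp: inputs_def frame_def prog_defs represents_def\<close>)

lemma sweep_runs:
  assumes s: "inputs s" "tables s" "represents D s" and inv: "sweep_inv b D\<^sub>0 {} D"
  shows "runs (sweep b) s (\<lambda>n s'. \<exists>D'. represents D' s' \<and> sweep_inv b D\<^sub>0 {..<l} D' \<and>
    n \<le> 2 + 4 * (l + 1) * (l + 1) + 40 * (l + 1) * l)"
  unfolding sweep_def
proof (rule runs_For[where lo = 0 and hi = "l + 1" and
      Inv = "\<lambda>k t s'. \<exists>D'. represents D' s' \<and> sweep_inv b D\<^sub>0 (examined k 0) D' \<and>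
        t \<le> 1 + 4 * (l + 1) * k + potential (examined k 0) D'"], goal_cases)
  case (5)
  have "examined 0 0 = {}" by (simp add: examined_def)
  then show ?case using s inv by (auto simp: represents_def)
next
  case (6 k t s')
  then obtain D' where D': "represents D' s'" "sweep_inv b D\<^sub>0 (examined k 0) D'"
    "t \<le> 1 + 4 * (l + 1) * k + potential (examined k 0) D'" by blast
  note f = 6(5)[unfolded prog_defs frame_def, simplified]
  have s': "inputs s'" "tables s'"
    using s f by (simp_all add: inputs_def tables_def)
  have rep: "represents D'' (s''\<lparr>ivar := g\<rparr>) \<longleftrightarrow> represents D'' s''" for D'' s'' g
    by (simp add: represents_def)
  show ?case
    unfolding rep
    by (rule runs_mono[OF sweep_degree_runs[OF s' D'(1) 6(4) D'(2)]])
      (use D'(3) in \<open>fastforce simp: algebra_simps\<close>)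
next
  case (7 t s')
  then obtain D' where D': "represents D' s'" "sweep_inv b D\<^sub>0 {..<l} D'"
    "t \<le> 1 + 4 * (l + 1) * (l + 1) + potential {..<l} D'"
    by (auto simp: examined_all)
  \<comment> \<open>Examined trips and passengers number at most \<open>l\<close> each, which bounds
    the telescoped potential.\<close>
  have "card {j. j < l \<and> D' j \<noteq> j} \<le> card {..<l}" by (intro card_mono) auto
  then have "potential {..<l} D' \<le> 20 * (l + 1) * (l + l)"
    unfolding potential_def by (intro mult_le_mono2) simp
  also have "\<dots> = 40 * (l + 1) * l" by (simp add: algebra_simps)
  finally show ?case using D' by (intro exI[of _ D']) simp
qed (use s in \<open>auto simp: inputs_def frame_def prog_defs\<close>)

section \<open>The input arrays and the total running time\<close>

lemma all_paths_eq: "all_paths I = map (route I) [0..<l]"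
proof -
  have "map preferred (trips I) = map (\<lambda>i. [route I i]) [0..<l]"
    by (rule nth_equalityI) (simp_all add: preferred_eq)
  then show ?thesis by (simp add: all_paths_def concat_map_singleton)
qed

lemma int_array_nth: "k < length xs \<Longrightarrow> int_array xs (int k) = int (xs ! k)"
  by (simp add: int_array_def array_of_def)

lemma inputs_input_state: "inputs (input_state I)"
  by (simp add: inputs_def input_state_def int_array_nth)

lemma path_inputs_input_state: "path_inputs (input_state I)"
  unfolding path_inputs_def
proof (intro allI impI)
  fix i assume i: "i < l"
  have len: "length (all_paths I) = l" by (simp add: all_paths_eq)
  have arrays: "iarr (input_state I) ''vertstart'' = int_array (offsets (all_paths I))"
    "iarr (input_state I) ''pathvert'' = int_array (concat (all_paths I))"
    by (simp_all add: input_state_def)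
  have start: "int_array (offsets (all_paths I)) (int k) = int (offset k)" if "k \<le> l" for k
    using that len by (subst int_array_nth) (simp_all add: offsets_def offset_def del: upt_Suc)
  have ith: "all_paths I ! i = route I i" using i by (simp add: all_paths_eq)
  have next_offset: "offset (Suc i) = offset i + length (route I i)"
    using i len ith by (simp add: offset_def take_Suc_conv_app_nth)
  have concat: "concat (all_paths I) =
      concat (take i (all_paths I)) @ route I i @ concat (drop (Suc i) (all_paths I))"
    using i len ith by (metis concat.simps(2) concat_append id_take_nth_drop)
  have "int_array (concat (all_paths I)) (int (offset i + r)) = int (route I i ! r)"
    if "r < length (route I i)" for r
    using that by (subst int_array_nth) (simp_all add: concat offset_def nth_append)
  then show "iarr (input_state I) ''vertstart'' (int i) = int (offset i) \<and>
      iarr (input_state I) ''vertstart'' (int i + 1) = int (offset i + length (route I i)) \<and>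
      (\<forall>r<length (route I i). iarr (input_state I) ''pathvert'' (int (offset i + r)) =
        int (route I i ! r))"
    using start[of i] start[of "Suc i"] i next_offset unfolding arrays
    by (simp add: add.commute)
qed

lemma tables_input_state:
  "a \<in> {''mark'', ''row'', ''deg'', ''adj'', ''load''} \<Longrightarrow> iarr (input_state I) a x = 0"
  by (elim insertE emptyE) (simp_all add: input_state_def)

text \<open>The 9 consists of the 8 fixed entries of a trip and the length entry of its only
  path.\<close>

lemma instance_size_ge: "3 + (\<Sum>i<l. 9 + length (route I i)) \<le> instance_size I"
proof -
  have "(\<Sum>T\<leftarrow>trips I. 8 + (\<Sum>P\<leftarrow>preferred T. 1 + length P)) =
      (\<Sum>i<l. 8 + (\<Sum>P\<leftarrow>preferred (trip_of I i). 1 + length P))"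
    by (simp add: sum_list_sum_nth atLeast0LessThan)
  also have "\<dots> = (\<Sum>i<l. 9 + length (route I i))"
    by (rule sum.cong) (simp_all add: preferred_eq)
  finally show ?thesis by (simp add: instance_size_def)
qed

lemma represents_output:
  assumes "represents D s"
  shows "output_drivers I s = {i. i < l \<and> D i = i}"
    and "output_served I s = (\<lambda>i. {j. j < l \<and> D j = i})"
  using assms by (auto simp: output_drivers_def output_served_def represents_def fun_eq_iff)

lemma ridesharing_prog_runs:
  "runs ridesharing_prog (input_state I) (\<lambda>n s. \<exists>D. represents D s \<and> valid D \<and>
     (\<forall>i<l. settled 0 D i) \<and> (\<forall>i<l. free D i \<longrightarrow> candidates 1 D i = {}) \<and>
     n \<le> 200 * (instance_size I + l\<^sup>2))"
  unfolding ridesharing_prog_def runs_Seq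
proof (rule runs_mono[OF setup_runs[OF inputs_input_state path_inputs_input_state
        tables_input_state]], assumption, goal_cases)
  case (1 n0 s0)
  then have s0: "inputs s0" "tables s0" "represents (\<lambda>j. j) s0"
    and n0: "n0 \<le> 2 + (\<Sum>i<l. 12 + 3 * length (route I i) + 5 * l)"
    by simp_all
  have inv0: "sweep_inv 0 (\<lambda>j. j) {} (\<lambda>j. j)"
    using valid_id free_id extends_refl by (simp add: sweep_inv_def)
  show ?case
  proof (rule runs_frame[OF sweep_runs[OF s0 inv0]], goal_cases)
    case (1 n1 s1)
    then obtain D1 where D1: "represents D1 s1" "sweep_inv 0 (\<lambda>j. j) {..<l} D1"
      and n1: "n1 \<le> 2 + 4 * (l + 1) * (l + 1) + 40 * (l + 1) * l" by blast
    have s1: "inputs s1" "tables s1"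
      using s0 1(2)[unfolded prog_defs frame_def, simplified]
      by (simp_all add: inputs_def tables_def)
    \<comment> \<open>Taking \<open>D1\<close> also as the base of the second sweep yields
      \<open>extends D1 D2\<close>, which carries \<open>settled 0\<close> over to the end.\<close>
    have inv1: "sweep_inv 1 D1 {} D1"
      using D1(2) extends_refl by (simp add: sweep_inv_def)
    show ?case
    proof (rule runs_mono[OF sweep_runs[OF s1 D1(1) inv1]], goal_cases)
      case (1 n2 s2)
      then obtain D2 where D2: "represents D2 s2" "sweep_inv 1 D1 {..<l} D2"
        and n2: "n2 \<le> 2 + 4 * (l + 1) * (l + 1) + 40 * (l + 1) * l" by blast
      have "settled 0 D2 i" if "i < l" for i
        using D1(2) D2(2) that settled_extends[of D1 D2 0 i] by (simp add: sweep_inv_def)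
      \<comment> \<open>A single candidate would already be a larger load than the empty one of a
        free trip.\<close>
      moreover have "candidates 1 D2 i = {}" if i: "i < l" "free D2 i" for i
      proof (rule ccontr)
        assume "candidates 1 D2 i \<noteq> {}"
        then obtain j where j: "j \<in> candidates 1 D2 i" by blast
        then have "feas i {j}" by (simp add: candidates_def rides_def)
        moreover have "settled 1 D2 i" using D2(2) i by (simp add: sweep_inv_def)
        ultimately have "card {j} \<le> card (passengers D2 i)"
          using j unfolding settled_def by blast
        then show False using i by (simp add: free_def)
      qed
      moreover have "n0 + (n1 + n2) \<le> 200 * (instance_size I + l\<^sup>2)"
      proof -
        \<comment> \<open>Three times the bound of \<open>instance_size_ge\<close> covers the part
          linear in the route lengths; the tests of all pairs give the quadratic term.\<close>
        have "(\<Sum>i<l. 12 + 3 * length (route I i) + 5 * l) + 9 \<le>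
            3 * instance_size I + 5 * l * l"
          using instance_size_ge
          by (simp add: sum.distrib sum_distrib_left[symmetric] algebra_simps)
        moreover have "3 + 9 * l \<le> instance_size I"
          using instance_size_ge by (simp add: sum.distrib)
        ultimately show ?thesis
          using n0 n1 n2 by (simp add: algebra_simps power2_eq_square)
      qed
      ultimately show ?case using D2 by (auto simp: sweep_inv_def)
    qed
  qed
qed

end

theorem theorem10:
  shows "\<exists>(p :: prog) (c :: nat). \<forall>I :: instance_data.
    wf_instance I \<and> serve_reflexive I \<and>
    common_endpoint I \<and> zero_detour I \<and> single_path I \<and> common_time_window I \<and>
    serve_transitive I \<longrightarrow>
    (\<exists>n s. exec p (input_state I) n s \<and>
       n \<le> c * (instance_size I + (ntrips I)\<^sup>2) \<and>
       is_solution I (output_drivers I s) (output_served I s) \<and>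
       (\<forall>S\<^sub>o \<sigma>\<^sub>o. is_optimal I S\<^sub>o \<sigma>\<^sub>o \<longrightarrow>
          card S\<^sub>o \<le> card (output_drivers I s) \<and>
          real (card (output_drivers I s)) \<le>
            (real (Max (capacity ` set (trips I))) + 2) / 2 * real (card S\<^sub>o)))"
proof (rule exI[of _ ridesharing_prog], rule exI[of _ 200], intro allI impI)
  fix I :: instance_data
  assume "wf_instance I \<and> serve_reflexive I \<and>
    common_endpoint I \<and> zero_detour I \<and> single_path I \<and> common_time_window I \<and>
    serve_transitive I"
  then interpret ridesharing I by unfold_locales simp_all
  obtain n s D where run: "exec ridesharing_prog (input_state I) n s"
      "n \<le> 200 * (instance_size I + (ntrips I)\<^sup>2)"
    and rep: "represents D s" and D: "valid D"
    and greedy: "\<And>i. i < l \<Longrightarrow> settled 0 D i"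
      "\<And>i. i < l \<Longrightarrow> free D i \<Longrightarrow> candidates 1 D i = {}"
    using ridesharing_prog_runs unfolding runs_def by blast
  note out = represents_output[OF rep]
  have sol: "is_solution I (output_drivers I s) (output_served I s)"
    using is_solution_drivers[OF D] out by simp
  have "card S \<le> card (output_drivers I s)" if "is_optimal I S \<sigma>" for S \<sigma>
    using that sol by (auto simp: is_optimal_def)
  moreover have "real (card (output_drivers I s)) \<le>
      (real (Max (capacity ` set (trips I))) + 2) / 2 * real (card S)"
    if "is_optimal I S \<sigma>" for S \<sigma>
  proof -
    have "is_solution I S \<sigma>" using that by (simp add: is_optimal_def)
    with D greedy show ?thesis unfolding out by (rule approximation)
  qed
  ultimately show "\<exists>n s. exec ridesharing_prog (input_state I) n s \<and>
       n \<le> 200 * (instance_size I + (ntrips I)\<^sup>2) \<and>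
       is_solution I (output_drivers I s) (output_served I s) \<and>
       (\<forall>S\<^sub>o \<sigma>\<^sub>o. is_optimal I S\<^sub>o \<sigma>\<^sub>o \<longrightarrow>
          card S\<^sub>o \<le> card (output_drivers I s) \<and>
          real (card (output_drivers I s)) \<le>
            (real (Max (capacity ` set (trips I))) + 2) / 2 * real (card S\<^sub>o))"
    using run sol by blast
qed

end
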